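(* Let $\varphi:\mathbb{R}^n\to\overline{\mathbb{R}}$ be finite at $\bar x\in\mathbb{R}^n$ and have the composite representation $\varphi=g\circ\Phi$ around $\bar x$. Let $\bar v\in\partial\varphi(\bar x)$ and $\bar\lambda\in\Lambda(\bar x,\bar v)$. If the second-order qualification condition (SOQC) holds at $(\bar x,\bar\lambda)$, then the following properties are equivalent: (a) $\bar v\in\mathrm{ri}\,\partial\varphi(\bar x)$; (b) $\mathrm{gph}\,\partial\varphi$ is regular at $(\bar x,\bar v)$, that is, $\widehat N_{\mathrm{gph}\,\partial\varphi}(\bar x,\bar v)=N_{\mathrm{gph}\,\partial\varphi}(\bar x,\bar v)$; (c) for any $w\in\mathbb{R}^n$, $D(\partial\varphi)(\bar x,\bar v)(w)=D^*(\partial\varphi)(\bar x,\bar v)(w)$.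
   Context: $\overline{\mathbb{R}}=[-\infty,\infty]$; $\mathrm{ri}$ denotes relative interior. "$\varphi$ has the composite representation around $\bar x$" means: there are a neighborhood $O$ of $\bar x$, a mapping $\Phi:\mathbb{R}^n\to\mathbb{R}^m$ twice continuously differentiable around $\bar x$, and a polyhedral function $g:\mathbb{R}^m\to\overline{\mathbb{R}}$ (proper, with $\mathrm{epi}\,g$ a polyhedral convex set) such that $\varphi(x)=g(\Phi(x))$ for all $x\in O$. $\nabla\Phi(x)$ is the Jacobian and $\nabla\Phi(x)^*$ its transpose. Tangent cone: $T_\Omega(\bar x)=\limsup_{t\searrow0}(\Omega-\bar x)/t$. Regular normal cone: $\widehat N_\Omega(\bar x)=T_\Omega(\bar x)^*$ (polar cone). Limiting normal cone $N_\Omega(\bar x)$: all limits of $v^k\in\widehat N_\Omega(x^k)$ with $x^k\to\bar x$, $x^k\in\Omega$. Subdifferential: $\partial f(\bar x)=\{v : (v,-1)\in N_{\mathrm{epi} f}(\bar x,f(\bar x))\}$. For a set-valued mapping $F$ and $(\bar x,\bar y)\in\mathrm{gph}F$, the graphical derivative $DF(\bar x,\bar y)$ is the set-valued mapping with $\mathrm{gph}\,DF(\bar x,\bar y)=T_{\mathrm{gph}F}(\bar x,\bar y)$, and the coderivative is given by $w\in D^*F(\bar x,\bar y)(u)\iff(w,-u)\in N_{\mathrm{gph}F}(\bar x,\bar y)$. Multipliers: $\Lambda(x,v)=\{\lambda\in\mathbb{R}^m : \nabla\Phi(x)^*\lambda=v,\ \lambda\in\partial g(\Phi(x))\}$. SOQC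 at $(\bar x,\bar\lambda)$: $D^*(\partial g)(\Phi(\bar x),\bar\lambda)(0)\cap\ker\nabla\Phi(\bar x)^*=\{0\}$. *)

theory Defs
  imports "HOL-Analysis.Analysis"
begin

definition tangent_cone :: "'a::real_normed_vector set \<Rightarrow> 'a \<Rightarrow> 'a set" where
  "tangent_cone \<Omega> x =
     {w. \<exists>t u. (\<forall>k::nat. t k > (0::real)) \<and> t \<longlonglongrightarrow> 0 \<and> u \<longlonglongrightarrow> w \<and> (\<forall>k. x + t k *\<^sub>R u k \<in> \<Omega>)}"

definition polar_cone :: "'a::real_inner set \<Rightarrow> 'a set" where
  "polar_cone K = {v. \<forall>w\<in>K. v \<bullet> w \<le> 0}"

(* The two normal cones and the two derivatives of set-valued mappings below are
   meaningful only at points of the set (respectively of the graph). *)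

definition regular_normal_cone :: "'a::real_inner set \<Rightarrow> 'a \<Rightarrow> 'a set" where
  "regular_normal_cone \<Omega> x = polar_cone (tangent_cone \<Omega> x)"

definition limiting_normal_cone :: "'a::real_inner set \<Rightarrow> 'a \<Rightarrow> 'a set" where
  "limiting_normal_cone \<Omega> x =
     {v. \<exists>y u. (\<forall>k::nat. y k \<in> \<Omega> \<and> u k \<in> regular_normal_cone \<Omega> (y k))
               \<and> y \<longlonglongrightarrow> x \<and> u \<longlonglongrightarrow> v}"

(* The library's epigraph covers only real-valued functions. *)
definition epi :: "('a \<Rightarrow> ereal) \<Rightarrow> ('a \<times> real) set" where
  "epi f = {(x, \<alpha>). f x \<le> ereal \<alpha>}"

(* Empty, by the usual convention, where f is not finite. *)
definition subdifferential :: "('a::real_inner \<Rightarrow> ereal) \<Rightarrow> 'a \<Rightarrow> 'a set" where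
  "subdifferential f x =
     {v. \<bar>f x\<bar> \<noteq> \<infinity> \<and> (v, -1) \<in> limiting_normal_cone (epi f) (x, real_of_ereal (f x))}"

definition gph :: "('a \<Rightarrow> 'b set) \<Rightarrow> ('a \<times> 'b) set" where
  "gph F = {(x, y). y \<in> F x}"

definition graphical_derivative ::
  "('a::real_normed_vector \<Rightarrow> 'b::real_normed_vector set) \<Rightarrow> 'a \<Rightarrow> 'b \<Rightarrow> 'a \<Rightarrow> 'b set" where
  "graphical_derivative F x y w = {z. (w, z) \<in> tangent_cone (gph F) (x, y)}"

definition coderivative ::
  "('a::real_inner \<Rightarrow> 'b::real_inner set) \<Rightarrow> 'a \<Rightarrow> 'b \<Rightarrow> 'b \<Rightarrow> 'a set" where
  "coderivative F x y u = {w. (w, - u) \<in> limiting_normal_cone (gph F) (x, y)}"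

definition proper_fun :: "('a \<Rightarrow> ereal) \<Rightarrow> bool" where
  "proper_fun g \<longleftrightarrow> (\<forall>x. g x \<noteq> -\<infinity>) \<and> (\<exists>x. g x \<noteq> \<infinity>)"

definition polyhedral_fun :: "('a::euclidean_space \<Rightarrow> ereal) \<Rightarrow> bool" where
  "polyhedral_fun g \<longleftrightarrow> proper_fun g \<and> polyhedron (epi g)"

definition C2_around :: "('a::real_normed_vector \<Rightarrow> 'b::real_normed_vector) \<Rightarrow> 'a \<Rightarrow> bool" where
  "C2_around \<Phi> x \<longleftrightarrow>
     (\<exists>U (\<Phi>1 :: 'a \<Rightarrow> 'a \<Rightarrow>\<^sub>L 'b) (\<Phi>2 :: 'a \<Rightarrow> 'a \<Rightarrow>\<^sub>L 'a \<Rightarrow>\<^sub>L 'b).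
        open U \<and> x \<in> U \<and>
        (\<forall>y\<in>U. (\<Phi> has_derivative blinfun_apply (\<Phi>1 y)) (at y)) \<and>
        (\<forall>y\<in>U. (\<Phi>1 has_derivative blinfun_apply (\<Phi>2 y)) (at y)) \<and>
        continuous_on U \<Phi>2)"

definition composite_representation ::
  "(real^'n \<Rightarrow> ereal) \<Rightarrow> (real^'m \<Rightarrow> ereal) \<Rightarrow> (real^'n \<Rightarrow> real^'m) \<Rightarrow> real^'n \<Rightarrow> bool" where
  "composite_representation \<phi> g \<Phi> x \<longleftrightarrow>
     C2_around \<Phi> x \<and> polyhedral_fun g \<and> (\<exists>U. open U \<and> x \<in> U \<and> (\<forall>y\<in>U. \<phi> y = g (\<Phi> y)))"

definition multipliers ::
  "(real^'m \<Rightarrow> ereal) \<Rightarrow> (real^'n \<Rightarrow> real^'m) \<Rightarrow> real^'n \<Rightarrow> real^'n \<Rightarrow> (real^'m) set" where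
  "multipliers g \<Phi> x v =
     {l. transpose (jacobian \<Phi> (at x)) *v l = v \<and> l \<in> subdifferential g (\<Phi> x)}"

definition SOQC ::
  "(real^'m \<Rightarrow> ereal) \<Rightarrow> (real^'n \<Rightarrow> real^'m) \<Rightarrow> real^'n \<Rightarrow> real^'m \<Rightarrow> bool" where
  "SOQC g \<Phi> x l \<longleftrightarrow>
     coderivative (subdifferential g) (\<Phi> x) l 0 \<inter> {u. transpose (jacobian \<Phi> (at x)) *v u = 0} = {0}"

end

theory Submission
  imports Defs
begin

text \<open>Near a point of its domain \<open>g\<close> is a constant plus the support function of
  \<open>C = \<partial>g(\<Phi> x)\<close>, so nearby subdifferentials of \<open>g\<close> are exposed faces of \<open>C\<close>. Multipliers in the relative
  interior of \<open>C\<close> show that (SOQC) makes the adjoint Jacobian injective on the direction space \<open>S\<close> of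
  \<open>C\<close>. This gives the exact chain rule \<open>\<partial>\<phi>(y) = \<nabla>\<Phi>(y)\<^sup>* \<partial>g(\<Phi> y)\<close> near \<open>x\<close>, and identifies (a) with
  \<open>l \<in> ri C\<close>. If \<open>l \<in> ri C\<close>, then near \<open>(x, v)\<close> the graph of \<open>\<partial>\<phi>\<close> is the
  manifold \<open>{(y, \<nabla>\<Phi>(y)\<^sup>* m) | m \<in> C}\<close> over the
  points \<open>y\<close> with \<open>\<Phi> y - \<Phi> x\<close> orthogonal to \<open>S\<close>; (b) is then clear, and (c) follows from
  the symmetry of the second derivative. Approximating \<open>l\<close> from \<open>ri C\<close> shows that the normal space
  of this manifold always lies in the limiting normal cone. If \<open>l \<notin> ri C\<close>, a hyperplane
  properly supporting \<open>C\<close> at \<open>l\<close> provides a tangent direction contradicting (b) and a normal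
  contradicting (c).\<close>

section \<open>Tangent and normal cones, second derivatives\<close>

text \<open>The derivative of \<open>\<Phi>\<close> at \<open>x\<close> need not be surjective.
  Injectivity of its adjoint on the direction space \<open>S\<close> lets one prescribe only the
  components of \<open>\<Phi>\<close> along \<open>S\<close>, and these are all that the faces of
  \<open>C\<close> see: two multipliers differ by an element of \<open>S\<close>, so a displacement
  orthogonal to \<open>S\<close> pairs equally with all of them and is absorbed by the fixed
  multiplier \<open>l\<close>. Membership in an exposed face is decided by exact comparisons, which
  an o(t) error would destroy. Hence tangent directions are realised by sequences along which the
  \<open>S\<close>-components of \<open>\<Phi>\<close> are exactly affine in the step. As
  \<open>C\<close> may be unbounded, bounds on multipliers come from a lower bound \<open>c\<close>
  for the adjoint on \<open>S\<close> that is uniform near \<open>x\<close>; it also makes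
  multipliers unique and continuous along the graph. In the regular case the map from (w, z) to (z,
  -w) carries the tangent space of the graph onto its orthogonal complement; this is where symmetry
  of the second derivative enters.\<close>

lemma tangent_coneI:
  assumes "\<And>k::nat. t k > (0::real)" "t \<longlonglongrightarrow> 0" "u \<longlonglongrightarrow> w"
    and "\<forall>\<^sub>F k in sequentially. x + t k *\<^sub>R u k \<in> \<Omega>"
  shows "w \<in> tangent_cone \<Omega> x"
proof -
  obtain N where N: "\<And>k. k \<ge> N \<Longrightarrow> x + t k *\<^sub>R u k \<in> \<Omega>"
    using assms(4) by (auto simp: eventually_sequentially)
  have "(\<lambda>k. t (k + N)) \<longlonglongrightarrow> 0" "(\<lambda>k. u (k + N)) \<longlonglongrightarrow> w"
    using assms(2,3) by (auto intro: LIMSEQ_ignore_initial_segment)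
  then show ?thesis
    unfolding tangent_cone_def using assms(1) N
    by (intro CollectI exI[of _ "\<lambda>k. t (k + N)"] exI[of _ "\<lambda>k. u (k + N)"]) auto
qed

lemma tangent_coneE:
  assumes "w \<in> tangent_cone \<Omega> x"
  obtains t u where "\<And>k::nat. t k > (0::real)" "t \<longlonglongrightarrow> 0" "u \<longlonglongrightarrow> w" "\<And>k. x + t k *\<^sub>R u k \<in> \<Omega>"
  using assms unfolding tangent_cone_def by blast

lemma tangent_base_tendsto:
  fixes t :: "nat \<Rightarrow> real" and u :: "nat \<Rightarrow> 'a::real_normed_vector"
  assumes "t \<longlonglongrightarrow> 0" "u \<longlonglongrightarrow> w"
  shows "(\<lambda>k. x + t k *\<^sub>R u k) \<longlonglongrightarrow> x"
  using tendsto_add[OF tendsto_const tendsto_scaleR[OF assms], of x] by simp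

lemma limiting_normalI:
  assumes "\<forall>\<^sub>F k in sequentially. y k \<in> \<Omega> \<and> u k \<in> regular_normal_cone \<Omega> (y k)"
    and "y \<longlonglongrightarrow> x" "u \<longlonglongrightarrow> v"
  shows "v \<in> limiting_normal_cone \<Omega> x"
proof -
  obtain N where N: "\<And>k. k \<ge> N \<Longrightarrow> y k \<in> \<Omega> \<and> u k \<in> regular_normal_cone \<Omega> (y k)"
    using assms(1) by (auto simp: eventually_sequentially)
  have "(\<lambda>k. y (k + N)) \<longlonglongrightarrow> x" "(\<lambda>k. u (k + N)) \<longlonglongrightarrow> v"
    using assms(2,3) by (auto intro: LIMSEQ_ignore_initial_segment)
  then show ?thesis
    unfolding limiting_normal_cone_def using N
    by (intro CollectI exI[of _ "\<lambda>k. y (k + N)"] exI[of _ "\<lambda>k. u (k + N)"]) auto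
qed

lemma limiting_normalE:
  assumes "v \<in> limiting_normal_cone \<Omega> x"
  obtains y u where "\<And>k::nat. y k \<in> \<Omega>" "\<And>k. u k \<in> regular_normal_cone \<Omega> (y k)" "y \<longlonglongrightarrow> x" "u \<longlonglongrightarrow> v"
  using assms unfolding limiting_normal_cone_def by blast

lemma regular_subset_limiting:
  assumes "x \<in> \<Omega>" shows "regular_normal_cone \<Omega> x \<subseteq> limiting_normal_cone \<Omega> x"
proof
  fix v assume "v \<in> regular_normal_cone \<Omega> x"
  then show "v \<in> limiting_normal_cone \<Omega> x"
    using assms by (intro limiting_normalI[of "\<lambda>_. x" _ "\<lambda>_. v"]) auto
qed

lemma regular_normalD:
  "v \<in> regular_normal_cone \<Omega> x \<Longrightarrow> w \<in> tangent_cone \<Omega> x \<Longrightarrow> v \<bullet> w \<le> 0"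
  by (simp add: regular_normal_cone_def polar_cone_def)

lemma regular_normalI:
  "(\<And>w. w \<in> tangent_cone \<Omega> x \<Longrightarrow> v \<bullet> w \<le> 0) \<Longrightarrow> v \<in> regular_normal_cone \<Omega> x"
  by (simp add: regular_normal_cone_def polar_cone_def)

lemma convex_tangent_direction:
  assumes "convex P" "e \<in> P" "z \<in> P"
  shows "z - e \<in> tangent_cone P e"
proof (rule tangent_coneI)
  show "\<forall>\<^sub>F k in sequentially. e + (1 / real (Suc k)) *\<^sub>R (z - e) \<in> P"
  proof (intro always_eventually allI)
    fix k
    have "(1 - 1 / real (Suc k)) *\<^sub>R e + (1 / real (Suc k)) *\<^sub>R z \<in> P"
      using assms by (intro convexD_alt) auto
    then show "e + (1 / real (Suc k)) *\<^sub>R (z - e) \<in> P"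
      by (simp add: algebra_simps)
  qed
qed (use LIMSEQ_inverse_real_of_nat in \<open>auto simp: inverse_eq_divide\<close>)

text \<open>For a fixed \<open>z\<close> in \<open>P\<close> the inequality at the approximating
  points passes to the limit, so limiting normals satisfy the inequality of convex analysis, and
  that inequality in turn makes a vector a regular normal.\<close>

lemma limiting_normal_convex:
  fixes P :: "'a::real_inner set"
  assumes "convex P" "e \<in> P"
  shows "v \<in> limiting_normal_cone P e \<longleftrightarrow> (\<forall>z\<in>P. v \<bullet> (z - e) \<le> 0)"
proof
  assume "v \<in> limiting_normal_cone P e"
  then obtain y u where yu: "\<And>k::nat. y k \<in> P" "\<And>k. u k \<in> regular_normal_cone P (y k)" "y \<longlonglongrightarrow> e" "u \<longlonglongrightarrow> v"
    by (rule limiting_normalE) blast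
  show "\<forall>z\<in>P. v \<bullet> (z - e) \<le> 0"
  proof
    fix z assume "z \<in> P"
    then have "u k \<bullet> (z - y k) \<le> 0" for k
      using regular_normalD[OF yu(2) convex_tangent_direction[OF assms(1) yu(1)]] by blast
    moreover have "(\<lambda>k. u k \<bullet> (z - y k)) \<longlonglongrightarrow> v \<bullet> (z - e)"
      by (intro tendsto_intros yu)
    ultimately show "v \<bullet> (z - e) \<le> 0"
      by (intro LIMSEQ_le_const2) auto
  qed
next
  assume *: "\<forall>z\<in>P. v \<bullet> (z - e) \<le> 0"
  have "v \<in> regular_normal_cone P e"
  proof (rule regular_normalI)
    fix w assume "w \<in> tangent_cone P e"
    then obtain t u where tu: "\<And>k::nat. t k > (0::real)" "t \<longlonglongrightarrow> 0" "u \<longlonglongrightarrow> w" "\<And>k. e + t k *\<^sub>R u k \<in> P"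
      by (rule tangent_coneE) blast
    have "v \<bullet> u k \<le> 0" for k
      using *[rule_format, OF tu(4)[of k]] tu(1)[of k] by (simp add: mult_le_0_iff)
    moreover have "(\<lambda>k. v \<bullet> u k) \<longlonglongrightarrow> v \<bullet> w"
      by (intro tendsto_intros tu)
    ultimately show "v \<bullet> w \<le> 0"
      by (intro LIMSEQ_le_const2) auto
  qed
  then show "v \<in> limiting_normal_cone P e"
    using regular_subset_limiting[OF assms(2)] by blast
qed

section \<open>Directional limits and symmetry of second derivatives\<close>

lemma directional_limit:
  fixes f :: "'a::real_normed_vector \<Rightarrow> 'b::real_normed_vector" and t :: "nat \<Rightarrow> real"
  assumes f: "(f has_derivative f') (at x)" and t: "\<And>k. t k > 0" "t \<longlonglongrightarrow> 0" and u: "u \<longlonglongrightarrow> w"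
  shows "(\<lambda>k. (f (x + t k *\<^sub>R u k) - f x) /\<^sub>R t k) \<longlonglongrightarrow> f' w"
proof -
  interpret f': bounded_linear f' using f by (rule has_derivative_bounded_linear)
  let ?h = "\<lambda>k. t k *\<^sub>R u k"
  \<comment> \<open>At \<open>h = 0\<close> the quotient is 0 by the convention for division by
    zero, so \<open>R\<close> is continuous at 0 and indices with \<open>u k = 0\<close> cause no
    trouble.\<close>
  define R where "R h = norm (f (x + h) - f x - f' h) / norm h" for h
  have "R \<midarrow>0\<rightarrow> 0"
    using f unfolding has_derivative_at R_def by blast
  moreover have "R 0 = 0" by (simp add: R_def)
  ultimately have "isCont R 0" by (simp add: isCont_def)
  moreover have "?h \<longlonglongrightarrow> 0"
    using tangent_base_tendsto[OF t(2) u, of 0] by simp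
  ultimately have Rh: "(\<lambda>k. R (?h k)) \<longlonglongrightarrow> 0"
    using isCont_tendsto_compose[of 0 R ?h sequentially] \<open>R 0 = 0\<close> by simp
  have "norm ((f (x + ?h k) - f x) /\<^sub>R t k - f' (u k)) = R (?h k) * norm (u k)" for k
  proof -
    have "(f (x + ?h k) - f x) /\<^sub>R t k - f' (u k) = (f (x + ?h k) - f x - f' (?h k)) /\<^sub>R t k"
      using t(1)[of k] by (simp add: f'.scaleR scaleR_diff_right)
    then show ?thesis
      using t(1)[of k] by (cases "u k = 0") (simp_all add: R_def f'.zero divide_simps)
  qed
  then have "(\<lambda>k. norm ((f (x + ?h k) - f x) /\<^sub>R t k - f' (u k))) \<longlonglongrightarrow> 0"
    using tendsto_mult[OF Rh tendsto_norm[OF u]] by simp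
  then have "(\<lambda>k. (f (x + ?h k) - f x) /\<^sub>R t k - f' (u k)) \<longlonglongrightarrow> 0"
    by (rule tendsto_norm_zero_cancel)
  from tendsto_add[OF this f'.tendsto[OF u]] show ?thesis by simp
qed

text \<open>The difference in direction \<open>u\<close> is treated as a function of the step along
  \<open>v\<close>; the mean value theorem turns it into a difference of first derivatives, which
  differentiability of \<open>f1\<close> at \<open>x\<close> evaluates.\<close>

lemma second_difference_bound:
  fixes f :: "'a::real_normed_vector \<Rightarrow> real" and f1 :: "'a \<Rightarrow> 'a \<Rightarrow>\<^sub>L real"
  assumes U: "open U" "x \<in> U" and f1: "\<And>y. y \<in> U \<Longrightarrow> (f has_derivative blinfun_apply (f1 y)) (at y)"
    and f2: "(f1 has_derivative f2) (at x)" and "e > 0"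
  shows "\<exists>d>0. \<forall>t. 0 < t \<and> t < d \<longrightarrow>
    \<bar>f (x + t *\<^sub>R u + t *\<^sub>R v) - f (x + t *\<^sub>R u) - f (x + t *\<^sub>R v) + f x - t\<^sup>2 * f2 u v\<bar> \<le> e * t\<^sup>2"
proof -
  interpret f2: bounded_linear f2 using f2 by (rule has_derivative_bounded_linear)
  define M where "M = norm u + norm v + 1"
  have M: "M > 0" unfolding M_def by (smt (verit) norm_ge_zero)
  \<comment> \<open>Each of the two remainders will be at most \<open>e' * (t * M) * M\<close>, and
    this value makes their sum \<open>e * t\<close>.\<close>
  define e' where "e' = e / (2 * M * M)"
  have e': "e' > 0" using M \<open>e > 0\<close> by (simp add: e'_def)
  obtain d1 where d1: "d1 > 0" "ball x d1 \<subseteq> U" using U open_contains_ball by blast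
  obtain d2 where d2: "d2 > 0" "\<And>h. norm h < d2 \<Longrightarrow> norm (f1 (x + h) - f1 x - f2 h) \<le> e' * norm h"
  proof -
    obtain d where "d > 0" "\<And>y. norm (y - x) < d \<Longrightarrow> norm (f1 y - f1 x - f2 (y - x)) \<le> e' * norm (y - x)"
      using f2 e' unfolding has_derivative_at_alt by blast
    then show ?thesis using that[of d] by (metis add_diff_cancel_left')
  qed
  define d where "d = min d1 d2 / M"
  have "d > 0" using d1 d2 M by (simp add: d_def)
  moreover have "\<bar>f (x + t *\<^sub>R u + t *\<^sub>R v) - f (x + t *\<^sub>R u) - f (x + t *\<^sub>R v) + f x - t\<^sup>2 * f2 u v\<bar> \<le> e * t\<^sup>2"
    if t: "0 < t" "t < d" for t
  proof -
    have small: "norm (t *\<^sub>R (a *\<^sub>R u + s *\<^sub>R v)) \<le> t * M" "norm (t *\<^sub>R (a *\<^sub>R u + s *\<^sub>R v)) < min d1 d2"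
      if "0 \<le> s" "s \<le> 1" "0 \<le> a" "a \<le> 1" for s a
    proof -
      have "norm (a *\<^sub>R u + s *\<^sub>R v) \<le> norm (a *\<^sub>R u) + norm (s *\<^sub>R v)" by (rule norm_triangle_ineq)
      also have "\<dots> \<le> norm u + norm v" using that by (auto intro!: add_mono mult_left_le_one_le)
      finally have "norm (a *\<^sub>R u + s *\<^sub>R v) \<le> M" by (simp add: M_def)
      then show *: "norm (t *\<^sub>R (a *\<^sub>R u + s *\<^sub>R v)) \<le> t * M" using t by simp
      have "t * M < min d1 d2" using t(2) M by (simp add: d_def field_simps)
      then show "norm (t *\<^sub>R (a *\<^sub>R u + s *\<^sub>R v)) < min d1 d2" using * by simp
    qed
    \<comment> \<open>The coefficients 1 and 0 of \<open>u\<close> are kept visible so that the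
      estimates for general \<open>a\<close> apply to both terms.\<close>
    define h where "h s = f (x + t *\<^sub>R (1 *\<^sub>R u + s *\<^sub>R v)) - f (x + t *\<^sub>R (0 *\<^sub>R u + s *\<^sub>R v))" for s
    have der: "(h has_real_derivative
        t * (f1 (x + t *\<^sub>R (1 *\<^sub>R u + s *\<^sub>R v)) v - f1 (x + t *\<^sub>R (0 *\<^sub>R u + s *\<^sub>R v)) v)) (at s)"
      if s: "0 \<le> s" "s \<le> 1" for s
    proof -
      have a: "((\<lambda>s. f (x + t *\<^sub>R (a *\<^sub>R u + s *\<^sub>R v))) has_derivative
          (\<lambda>r. f1 (x + t *\<^sub>R (a *\<^sub>R u + s *\<^sub>R v)) (t *\<^sub>R (r *\<^sub>R v)))) (at s)"
        if "0 \<le> a" "a \<le> 1" for a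
      proof (rule has_derivative_compose[of "\<lambda>s. x + t *\<^sub>R (a *\<^sub>R u + s *\<^sub>R v)"])
        show "((\<lambda>s. x + t *\<^sub>R (a *\<^sub>R u + s *\<^sub>R v)) has_derivative (\<lambda>r. t *\<^sub>R (r *\<^sub>R v))) (at s)"
          by (auto intro!: derivative_eq_intros)
        have "x + t *\<^sub>R (a *\<^sub>R u + s *\<^sub>R v) \<in> ball x d1"
          using small(2)[OF s that] by (simp add: dist_norm)
        then show "(f has_derivative f1 (x + t *\<^sub>R (a *\<^sub>R u + s *\<^sub>R v))) (at (x + t *\<^sub>R (a *\<^sub>R u + s *\<^sub>R v)))"
          using d1 by (intro f1) blast
      qed
      have "(h has_derivative (\<lambda>r. f1 (x + t *\<^sub>R (1 *\<^sub>R u + s *\<^sub>R v)) (t *\<^sub>R (r *\<^sub>R v))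
              - f1 (x + t *\<^sub>R (0 *\<^sub>R u + s *\<^sub>R v)) (t *\<^sub>R (r *\<^sub>R v)))) (at s)"
        unfolding h_def by (intro has_derivative_diff a) auto
      then show ?thesis
        unfolding has_field_derivative_def
        by (rule has_derivative_eq_rhs) (auto simp: blinfun.scaleR_right algebra_simps)
    qed
    obtain s where s: "0 < s" "s < 1"
      and hs: "h 1 - h 0 = t * (f1 (x + t *\<^sub>R (1 *\<^sub>R u + s *\<^sub>R v)) v - f1 (x + t *\<^sub>R (0 *\<^sub>R u + s *\<^sub>R v)) v)"
      using MVT2[of 0 1 h, OF _ der] by auto
    define r where "r a = f1 (x + t *\<^sub>R (a *\<^sub>R u + s *\<^sub>R v)) - f1 x - f2 (t *\<^sub>R (a *\<^sub>R u + s *\<^sub>R v))" for a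
    have r: "norm (r a) \<le> e' * (t * M)" if "0 \<le> a" "a \<le> 1" for a
    proof -
      have "norm (r a) \<le> e' * norm (t *\<^sub>R (a *\<^sub>R u + s *\<^sub>R v))"
        unfolding r_def using small(2)[of s a] s that by (intro d2(2)) auto
      also have "\<dots> \<le> e' * (t * M)" using small(1)[of s a] s that e' by (intro mult_left_mono) auto
      finally show ?thesis .
    qed
    have "f1 (x + t *\<^sub>R (1 *\<^sub>R u + s *\<^sub>R v)) v - f1 (x + t *\<^sub>R (0 *\<^sub>R u + s *\<^sub>R v)) v
        = t * f2 u v + r 1 v - r 0 v"
      by (simp add: r_def f2.add f2.scaleR f2.zero blinfun.bilinear_simps algebra_simps)
    then have "h 1 - h 0 - t\<^sup>2 * f2 u v = t * (r 1 v - r 0 v)"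
      unfolding hs by (simp only: power2_eq_square) (simp only: algebra_simps)
    moreover have "\<bar>r 1 v - r 0 v\<bar> \<le> e * t"
    proof -
      have rv: "\<bar>r a v\<bar> \<le> e' * (t * M) * M" if "0 \<le> a" "a \<le> 1" for a
      proof -
        have "norm (r a v) \<le> norm (r a) * norm v" by (rule norm_blinfun)
        also have "\<dots> \<le> (e' * (t * M)) * M"
          using r[OF that] e' t M by (intro mult_mono) (auto simp: M_def)
        finally show ?thesis by simp
      qed
      have "\<bar>r 1 v - r 0 v\<bar> \<le> 2 * (e' * (t * M) * M)" using rv[of 0] rv[of 1] by simp
      also have "\<dots> = e * t" using M by (simp add: e'_def field_simps)
      finally show ?thesis .
    qed
    ultimately have "\<bar>h 1 - h 0 - t\<^sup>2 * f2 u v\<bar> \<le> t * (e * t)"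
      using t(1) by (simp add: abs_mult)
    then show ?thesis by (simp add: h_def power2_eq_square algebra_simps)
  qed
  ultimately show ?thesis by blast
qed

text \<open>Both sides are the limit of the second difference quotient
  \<open>(f (x + t u + t v) - f (x + t u) - f (x + t v) + f x) / t\<^sup>2\<close>, which is symmetric in \<open>u\<close> and \<open>v\<close>.\<close>

lemma second_derivative_symmetric:
  fixes f :: "'a::real_normed_vector \<Rightarrow> real" and f1 :: "'a \<Rightarrow> 'a \<Rightarrow>\<^sub>L real"
  assumes U: "open U" "x \<in> U" and f1: "\<And>y. y \<in> U \<Longrightarrow> (f has_derivative blinfun_apply (f1 y)) (at y)"
    and f2: "(f1 has_derivative f2) (at x)"
  shows "f2 u v = f2 v u"
proof -
  have "\<bar>f2 u v - f2 v u\<bar> \<le> 2 * e" if e: "e > 0" for e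
  proof -
    obtain d where d: "d > 0" "\<And>t. 0 < t \<and> t < d \<Longrightarrow>
      \<bar>f (x + t *\<^sub>R u + t *\<^sub>R v) - f (x + t *\<^sub>R u) - f (x + t *\<^sub>R v) + f x - t\<^sup>2 * f2 u v\<bar> \<le> e * t\<^sup>2"
      using second_difference_bound[OF assms e, of u v] by blast
    obtain d' where d': "d' > 0" "\<And>t. 0 < t \<and> t < d' \<Longrightarrow>
      \<bar>f (x + t *\<^sub>R v + t *\<^sub>R u) - f (x + t *\<^sub>R v) - f (x + t *\<^sub>R u) + f x - t\<^sup>2 * f2 v u\<bar> \<le> e * t\<^sup>2"
      using second_difference_bound[OF assms e, of v u] by blast
    define t where "t = min d d' / 2"
    have t: "0 < t" "t < d" "t < d'" using d d' by (auto simp: t_def)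
    have "x + t *\<^sub>R v + t *\<^sub>R u = x + t *\<^sub>R u + t *\<^sub>R v" by simp
    then have "\<bar>t\<^sup>2 * f2 u v - t\<^sup>2 * f2 v u\<bar> \<le> e * t\<^sup>2 + e * t\<^sup>2"
      using d(2)[of t] d'(2)[of t] t by (smt (verit))
    moreover have "\<bar>t\<^sup>2 * f2 u v - t\<^sup>2 * f2 v u\<bar> = t\<^sup>2 * \<bar>f2 u v - f2 v u\<bar>"
      by (simp add: abs_mult flip: right_diff_distrib)
    moreover have "e * t\<^sup>2 + e * t\<^sup>2 = t\<^sup>2 * (2 * e)" by simp
    ultimately have "t\<^sup>2 * \<bar>f2 u v - f2 v u\<bar> \<le> t\<^sup>2 * (2 * e)"
      by (simp only:)
    then show ?thesis using t by simp
  qed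
  from this[of "\<bar>f2 u v - f2 v u\<bar> / 4"] show ?thesis by (cases "f2 u v = f2 v u") auto
qed

section \<open>Polyhedral functions\<close>

text \<open>Quantifying over real bounds \<beta>, that is over points of the epigraph, avoids
  arithmetic with infinite values and lets arguments outside the domain of \<open>g\<close> drop out
  by themselves.\<close>

lemma subdifferential_convex:
  assumes "convex (epi g)"
  shows "l \<in> subdifferential g y \<longleftrightarrow>
    \<bar>g y\<bar> \<noteq> \<infinity> \<and> (\<forall>z \<beta>. g z \<le> ereal \<beta> \<longrightarrow> real_of_ereal (g y) + l \<bullet> (z - y) \<le> \<beta>)"
proof (cases "\<bar>g y\<bar> = \<infinity>")
  case True
  then show ?thesis by (simp add: subdifferential_def)
next
  case False
  then have e: "(y, real_of_ereal (g y)) \<in> epi g"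
    by (simp add: epi_def ereal_real')
  show ?thesis
    unfolding subdifferential_def limiting_normal_convex[OF assms e] mem_Collect_eq
    using False by (auto simp: epi_def inner_diff_right algebra_simps)
qed

lemma convex_subdifferential:
  assumes "convex (epi g)" shows "convex (subdifferential g y)"
proof (rule convexI)
  fix a b and u v :: real
  assume a: "a \<in> subdifferential g y" and b: "b \<in> subdifferential g y" and uv: "0 \<le> u" "0 \<le> v" "u + v = 1"
  show "u *\<^sub>R a + v *\<^sub>R b \<in> subdifferential g y"
    unfolding subdifferential_convex[OF assms]
  proof (intro conjI allI impI)
    show "\<bar>g y\<bar> \<noteq> \<infinity>" using a unfolding subdifferential_convex[OF assms] by simp
    fix z \<beta> assume z: "g z \<le> ereal \<beta>"
    let ?G = "real_of_ereal (g y)"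
    have "?G + a \<bullet> (z - y) \<le> \<beta>" "?G + b \<bullet> (z - y) \<le> \<beta>"
      using a b z unfolding subdifferential_convex[OF assms] by auto
    then have "u * (?G + a \<bullet> (z - y)) + v * (?G + b \<bullet> (z - y)) \<le> u * \<beta> + v * \<beta>"
      using uv by (intro add_mono mult_left_mono) auto
    moreover have "u * \<beta> + v * \<beta> = \<beta>" "u * ?G + v * ?G = ?G"
      using uv by (metis distrib_right mult_1)+
    ultimately show "?G + (u *\<^sub>R a + v *\<^sub>R b) \<bullet> (z - y) \<le> \<beta>"
      by (simp add: inner_add_left algebra_simps)
  qed
qed

text \<open>Since \<open>g\<close> need not be continuous, convergence of the values is a hypothesis
  of its own; it will come from a constant sequence or from converging points of an
  epigraph.\<close>

lemma subdifferential_limit: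
  assumes "convex (epi g)" and l: "\<And>k::nat. l k \<in> subdifferential g (y k)" "l \<longlonglongrightarrow> l'"
    and y: "y \<longlonglongrightarrow> y'" "(\<lambda>k. real_of_ereal (g (y k))) \<longlonglongrightarrow> real_of_ereal (g y')" and fin: "\<bar>g y'\<bar> \<noteq> \<infinity>"
  shows "l' \<in> subdifferential g y'"
  unfolding subdifferential_convex[OF assms(1)]
proof (intro conjI allI impI fin)
  fix z \<beta> assume z: "g z \<le> ereal \<beta>"
  have "real_of_ereal (g (y k)) + l k \<bullet> (z - y k) \<le> \<beta>" for k
    using l(1)[of k] z unfolding subdifferential_convex[OF assms(1)] by blast
  moreover have "(\<lambda>k. real_of_ereal (g (y k)) + l k \<bullet> (z - y k)) \<longlonglongrightarrow> real_of_ereal (g y') + l' \<bullet> (z - y')"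
    by (intro tendsto_intros l y)
  ultimately show "real_of_ereal (g y') + l' \<bullet> (z - y') \<le> \<beta>"
    by (intro LIMSEQ_le_const2) auto
qed

lemma closed_subdifferential:
  assumes "convex (epi g)" shows "closed (subdifferential g y)"
  unfolding closed_sequential_limits
proof (intro allI impI, elim conjE)
  fix f l assume "\<forall>n. f n \<in> subdifferential g y" "f \<longlonglongrightarrow> l"
  then show "l \<in> subdifferential g y"
    using subdifferential_limit[OF assms, of f "\<lambda>_. y" l y] subdifferential_convex[OF assms]
    by (metis tendsto_const)
qed

section \<open>Local structure of polyhedral functions\<close>

lemma polyhedral_fun_convex: "polyhedral_fun g \<Longrightarrow> convex (epi g)"
  by (simp add: polyhedral_fun_def polyhedron_imp_convex)

text \<open>A strictly separating functional works up to sign: its bound \<open>b\<close> is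
  negative because 0 lies in \<open>K\<close>, and a vector of \<open>K\<close> with negative
  pairing could be scaled inside the cone until its pairing equals \<open>b\<close>, which is
  excluded.\<close>

lemma separate_closed_cone:
  fixes K :: "'a::euclidean_space set"
  assumes "convex K" "closed K" "cone K" "0 \<in> K" "z \<notin> K"
  obtains c where "c \<bullet> z > 0" "\<And>k. k \<in> K \<Longrightarrow> c \<bullet> k \<le> 0"
proof -
  obtain a b where ab: "a \<bullet> z < b" "\<And>k. k \<in> K \<Longrightarrow> a \<bullet> k > b"
    using separating_hyperplane_closed_point[OF assms(1,2,5)] by blast
  have b: "b < 0" using ab(2)[OF assms(4)] by simp
  have "a \<bullet> k \<ge> 0" if "k \<in> K" for k
  proof (rule ccontr)
    assume neg: "\<not> ?thesis"
    then have "b / (a \<bullet> k) \<ge> 0" using b by (simp add: divide_nonpos_neg)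
    then have "(b / (a \<bullet> k)) *\<^sub>R k \<in> K" using that assms(3) by (simp add: cone_def)
    from ab(2)[OF this] neg show False by simp
  qed
  then show ?thesis using ab b by (intro that[of "- a"]) auto
qed

text \<open>The epigraph agrees locally with its closed tangent cone \<open>K\<close>, which is its own bipolar.\<close>

lemma polyhedral_fun_local:
  fixes g :: "'b::euclidean_space \<Rightarrow> ereal"
  assumes g: "polyhedral_fun g" and y: "\<bar>g y\<bar> \<noteq> \<infinity>"
  shows "subdifferential g y \<noteq> {}"
    and "\<exists>\<epsilon>>0. \<forall>u \<alpha>. norm u < \<epsilon> \<longrightarrow>
      (g (y + u) \<le> ereal (real_of_ereal (g y) + \<alpha>) \<longleftrightarrow> (\<forall>l\<in>subdifferential g y. l \<bullet> u \<le> \<alpha>))"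
proof -
  define G where "G = real_of_ereal (g y)"
  have gy: "g y = ereal G" using y by (simp add: G_def ereal_real')
  have conv: "convex (epi g)" by (rule polyhedral_fun_convex[OF g])
  note sub = subdifferential_convex[OF conv, of _ y, folded G_def]
  define e where "e = (y, G)"
  obtain F where F: "finite F" "epi g = \<Inter> F" "\<forall>h \<in> F. \<exists>a b. a \<noteq> 0 \<and> h = {x. a \<bullet> x \<le> b}"
    using g unfolding polyhedral_fun_def polyhedron_def by blast
  obtain a b where ab: "\<And>h. h \<in> F \<Longrightarrow> h = {x. a h \<bullet> x \<le> b h}"
    using F(3) by metis
  have mem: "z \<in> epi g \<longleftrightarrow> (\<forall>h\<in>F. a h \<bullet> z \<le> b h)" for z
    using F(2) ab by blast
  have e: "e \<in> epi g" by (simp add: e_def epi_def gy)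
  define Act where "Act = {h \<in> F. a h \<bullet> e = b h}"
  define K where "K = {z. \<forall>h\<in>Act. a h \<bullet> z \<le> 0}"
  have K: "convex K" "closed K" "cone K" "0 \<in> K"
  proof -
    have "K = (\<Inter>h\<in>Act. {z. a h \<bullet> z \<le> 0})" by (auto simp: K_def)
    then show "convex K" "closed K"
      by (auto intro!: convex_INT closed_INT convex_halfspace_le closed_halfspace_le)
    show "cone K" by (auto simp: K_def cone_def mult_le_0_iff)
    show "0 \<in> K" by (simp add: K_def)
  qed
  have down: "snd (a h) \<le> 0" if "h \<in> F" for h
  proof (rule ccontr)
    assume pos: "\<not> snd (a h) \<le> 0"
    \<comment> \<open>At height \<open>G + \<tau>\<close> the constraint \<open>h\<close> would be
      exceeded by \<open>snd (a h) > 0\<close>, although the epigraph is closed upwards.\<close>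
    define \<tau> where "\<tau> = (b h - a h \<bullet> e) / snd (a h) + 1"
    have "a h \<bullet> e \<le> b h" using e mem that by blast
    then have "\<tau> \<ge> 0" using pos by (simp add: \<tau>_def)
    then have "(y, G + \<tau>) \<in> epi g" by (simp add: epi_def gy)
    then have "a h \<bullet> (y, G + \<tau>) \<le> b h" using mem that by blast
    moreover have "a h \<bullet> (y, G + \<tau>) = a h \<bullet> e + snd (a h) * \<tau>"
      by (cases "a h") (simp add: e_def algebra_simps)
    moreover have "snd (a h) * \<tau> = b h - a h \<bullet> e + snd (a h)"
      using pos by (simp add: \<tau>_def field_simps)
    ultimately show False using pos by linarith
  qed
  \<comment> \<open>The slack of the inactive constraints fixes \<epsilon>. Bounding \<alpha> from
    below is enough, since \<open>snd (a h) \<le> 0\<close> makes raising \<alpha> harmless.\<close>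
  obtain \<epsilon> where \<epsilon>: "\<epsilon> > 0" and loc: "\<And>u \<alpha>. norm u < \<epsilon> \<Longrightarrow> \<alpha> > - \<epsilon> \<Longrightarrow> (u, \<alpha>) \<in> K \<Longrightarrow> e + (u, \<alpha>) \<in> epi g"
  proof -
    define \<epsilon> where "\<epsilon> = Min (insert 1 ((\<lambda>h. (b h - a h \<bullet> e) / (norm (fst (a h)) + \<bar>snd (a h)\<bar> + 1)) ` (F - Act)))"
    have "b h - a h \<bullet> e > 0" if "h \<in> F - Act" for h
    proof -
      have "a h \<bullet> e \<le> b h" "a h \<bullet> e \<noteq> b h" using that e mem by (auto simp: Act_def)
      then show ?thesis by simp
    qed
    moreover have np: "norm (fst (a h)) + \<bar>snd (a h)\<bar> + 1 > 0" for h
      by (smt (verit) norm_ge_zero)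
    ultimately have "\<epsilon> > 0" using F(1) by (auto simp: \<epsilon>_def)
    moreover have "e + (u, \<alpha>) \<in> epi g" if u: "norm u < \<epsilon>" and \<alpha>: "\<alpha> > - \<epsilon>" and uK: "(u, \<alpha>) \<in> K" for u \<alpha>
      unfolding mem
    proof
      fix h assume h: "h \<in> F"
      show "a h \<bullet> (e + (u, \<alpha>)) \<le> b h"
      proof (cases "h \<in> Act")
        case True
        then show ?thesis using uK by (force simp: K_def Act_def inner_add_right)
      next
        case False
        then have "\<epsilon> \<le> (b h - a h \<bullet> e) / (norm (fst (a h)) + \<bar>snd (a h)\<bar> + 1)"
          using h F(1) by (auto simp: \<epsilon>_def intro!: Min_le)
        then have 1: "\<epsilon> * (norm (fst (a h)) + \<bar>snd (a h)\<bar> + 1) \<le> b h - a h \<bullet> e"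
          using np[of h] by (simp add: pos_le_divide_eq)
        have "fst (a h) \<bullet> u \<le> norm (fst (a h)) * norm u" by (rule norm_cauchy_schwarz)
        also have "\<dots> \<le> norm (fst (a h)) * \<epsilon>" using u by (intro mult_left_mono) auto
        finally have 2: "fst (a h) \<bullet> u \<le> norm (fst (a h)) * \<epsilon>" .
        have "snd (a h) * \<alpha> \<le> snd (a h) * (- \<epsilon>)"
          using down[OF h] \<alpha> by (intro mult_left_mono_neg) auto
        also have "\<dots> = \<bar>snd (a h)\<bar> * \<epsilon>" using down[OF h] by simp
        finally have "snd (a h) * \<alpha> \<le> \<bar>snd (a h)\<bar> * \<epsilon>" .
        with 1 2 \<open>\<epsilon> > 0\<close> have "fst (a h) \<bullet> u + snd (a h) * \<alpha> \<le> b h - a h \<bullet> e"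
          by (simp add: algebra_simps)
        moreover have "a h \<bullet> (u, \<alpha>) = fst (a h) \<bullet> u + snd (a h) * \<alpha>"
          by (cases "a h") simp
        ultimately show ?thesis by (simp add: inner_add_right)
      qed
    qed
    ultimately show ?thesis using that by blast
  qed
  have KI: "z - e \<in> K" if "z \<in> epi g" for z
    using that mem by (auto simp: K_def Act_def inner_diff_right)
  have up: "(0, 1) \<in> K"
    using KI[of "(y, G + 1)"] by (simp add: e_def epi_def gy)
  have dn: "(0, -1) \<notin> K"
  proof
    assume "(0, -1) \<in> K"
    then have "(\<epsilon>/2) *\<^sub>R (0, -1) \<in> K" using K(3) \<epsilon> unfolding cone_def by (meson half_gt_zero less_imp_le)
    then have "e + (0, - \<epsilon>/2) \<in> epi g" using \<epsilon> by (intro loc) auto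
    then show False using \<epsilon> by (simp add: e_def epi_def gy)
  qed
  have polar: "(1/\<beta>) *\<^sub>R p \<in> subdifferential g y" if "\<beta> > 0" "\<And>k. k \<in> K \<Longrightarrow> (p, - \<beta>) \<bullet> k \<le> 0" for p \<beta>
    unfolding sub
  proof (intro conjI allI impI y)
    fix z \<gamma> assume "g z \<le> ereal \<gamma>"
    then have "(z, \<gamma>) - e \<in> K" by (intro KI) (simp add: epi_def)
    from that(2)[OF this] have "p \<bullet> (z - y) \<le> \<beta> * (\<gamma> - G)" by (simp add: e_def)
    then show "G + ((1/\<beta>) *\<^sub>R p) \<bullet> (z - y) \<le> \<gamma>" using that(1) by (simp add: field_simps)
  qed
  have neg: "snd c \<le> 0" if "\<And>k. k \<in> K \<Longrightarrow> c \<bullet> k \<le> 0" for c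
    using that[OF up] by (cases c) simp
  \<comment> \<open>Separating \<open>(0, -1)\<close> from \<open>K\<close> gives a polar vector
    with negative last component; rescaling that component to -1 gives a subgradient.\<close>
  obtain l0 where l0: "l0 \<in> subdifferential g y"
  proof -
    obtain c where c: "c \<bullet> (0, -1) > 0" "\<And>k. k \<in> K \<Longrightarrow> c \<bullet> k \<le> 0"
      using separate_closed_cone[OF K dn] by blast
    then show ?thesis
      using that polar[of "- snd c" "fst c"] by (cases c) auto
  qed
  then show "subdifferential g y \<noteq> {}" by blast
  have bipolar: "(u, \<alpha>) \<in> K" if *: "\<And>l. l \<in> subdifferential g y \<Longrightarrow> l \<bullet> u \<le> \<alpha>" for u \<alpha>
  proof (rule ccontr)
    assume "(u, \<alpha>) \<notin> K"
    then obtain c where c: "c \<bullet> (u, \<alpha>) > 0" "\<And>k. k \<in> K \<Longrightarrow> c \<bullet> k \<le> 0"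
      using separate_closed_cone[OF K] by blast
    obtain p \<beta> where pb: "c = (p, - \<beta>)" by (metis add.inverse_inverse surj_pair)
    have "\<beta> \<ge> 0" using neg[OF c(2)] pb by simp
    show False
    proof (cases "\<beta> = 0")
      case False
      then have "\<beta> > 0" using \<open>\<beta> \<ge> 0\<close> by simp
      then have "((1/\<beta>) *\<^sub>R p) \<bullet> u \<le> \<alpha>" using polar c(2) pb * by blast
      then show False using c(1) pb \<open>\<beta> > 0\<close> by (simp add: field_simps)
    next
      case True
      then have pu: "p \<bullet> u > 0" using c(1) pb by simp
      \<comment> \<open>A horizontal polar vector \<open>p\<close> is a recession direction of the
        subdifferential; going this far along it from \<open>l0\<close> pushes the pairing with
        \<open>u\<close> above \<alpha>.\<close>
      define \<tau> where "\<tau> = \<bar>\<alpha> - l0 \<bullet> u\<bar> / (p \<bullet> u) + 1"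
      have \<tau>: "\<tau> > 0" using pu unfolding \<tau>_def by (smt (verit) divide_nonneg_pos)
      have "l0 + \<tau> *\<^sub>R p \<in> subdifferential g y"
        unfolding sub
      proof (intro conjI allI impI y)
        fix z \<gamma> assume z: "g z \<le> ereal \<gamma>"
        then have "(z, \<gamma>) - e \<in> K" by (intro KI) (simp add: epi_def)
        from c(2)[OF this] have "p \<bullet> (z - y) \<le> 0" using pb True by (simp add: e_def)
        then have "\<tau> * (p \<bullet> (z - y)) \<le> 0" using \<tau> by (simp add: mult_le_0_iff)
        moreover have "G + l0 \<bullet> (z - y) \<le> \<gamma>" using l0 z unfolding sub by blast
        ultimately show "G + (l0 + \<tau> *\<^sub>R p) \<bullet> (z - y) \<le> \<gamma>" by (simp add: inner_add_left)
      qed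
      from *[OF this] have "l0 \<bullet> u + \<tau> * (p \<bullet> u) \<le> \<alpha>" by (simp add: inner_add_left)
      moreover have "\<tau> * (p \<bullet> u) = \<bar>\<alpha> - l0 \<bullet> u\<bar> + p \<bullet> u" using pu by (simp add: \<tau>_def field_simps)
      ultimately show False using pu by linarith
    qed
  qed
  \<comment> \<open>Within this radius the bound \<open>l0 \<bullet> u \<le> \<alpha>\<close> forces
    \<open>\<alpha> > - \<epsilon>\<close>, which \<open>loc\<close> requires.\<close>
  define \<delta> where "\<delta> = \<epsilon> / (norm l0 + 1)"
  have \<delta>: "\<delta> > 0" "\<delta> \<le> \<epsilon>" "norm l0 * \<delta> < \<epsilon>"
  proof -
    have n: "norm l0 + 1 > 0" by (smt (verit) norm_ge_zero)
    then show "\<delta> > 0" using \<epsilon> by (simp add: \<delta>_def)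
    show "\<delta> \<le> \<epsilon>" unfolding \<delta>_def using \<epsilon> n by (simp add: field_simps)
    have "(norm l0 + 1) * \<delta> = \<epsilon>" using n by (simp add: \<delta>_def)
    then show "norm l0 * \<delta> < \<epsilon>" using \<open>\<delta> > 0\<close> by (simp add: algebra_simps)
  qed
  have "g (y + u) \<le> ereal (G + \<alpha>) \<longleftrightarrow> (\<forall>l\<in>subdifferential g y. l \<bullet> u \<le> \<alpha>)" if u: "norm u < \<delta>" for u \<alpha>
  proof
    assume "g (y + u) \<le> ereal (G + \<alpha>)"
    then have "G + l \<bullet> (y + u - y) \<le> G + \<alpha>" if "l \<in> subdifferential g y" for l
      using that unfolding sub by blast
    then show "\<forall>l\<in>subdifferential g y. l \<bullet> u \<le> \<alpha>" by simp
  next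
    assume *: "\<forall>l\<in>subdifferential g y. l \<bullet> u \<le> \<alpha>"
    then have "(u, \<alpha>) \<in> K" using bipolar by blast
    moreover have "\<alpha> > - \<epsilon>"
    proof -
      have "\<bar>l0 \<bullet> u\<bar> \<le> norm l0 * norm u" by (rule Cauchy_Schwarz_ineq2)
      also have "\<dots> \<le> norm l0 * \<delta>" using u by (intro mult_left_mono) auto
      finally show ?thesis using \<delta>(3) * l0 by fastforce
    qed
    ultimately have "e + (u, \<alpha>) \<in> epi g" using u \<delta> by (intro loc) auto
    then show "g (y + u) \<le> ereal (G + \<alpha>)" by (simp add: e_def epi_def)
  qed
  then show "\<exists>\<epsilon>>0. \<forall>u \<alpha>. norm u < \<epsilon> \<longrightarrow>
      (g (y + u) \<le> ereal (real_of_ereal (g y) + \<alpha>) \<longleftrightarrow> (\<forall>l\<in>subdifferential g y. l \<bullet> u \<le> \<alpha>))"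
    using \<delta>(1) unfolding G_def by blast
qed

lemma polyhedral_subdifferential_nearby:
  fixes g :: "'b::euclidean_space \<Rightarrow> ereal"
  assumes g: "polyhedral_fun g" and y: "\<bar>g y\<bar> \<noteq> \<infinity>"
  obtains \<epsilon> where "\<epsilon> > 0"
    "\<And>z. norm (z - y) < \<epsilon> \<Longrightarrow> subdifferential g z =
       {l \<in> subdifferential g y. \<forall>m\<in>subdifferential g y. m \<bullet> (z - y) \<le> l \<bullet> (z - y)}"
proof -
  define G where "G = real_of_ereal (g y)"
  have gy: "g y = ereal G" using y by (simp add: G_def ereal_real')
  have conv: "convex (epi g)" by (rule polyhedral_fun_convex[OF g])
  note sub = subdifferential_convex[OF conv]
  let ?C = "subdifferential g y"
  obtain \<epsilon> where \<epsilon>: "\<epsilon> > 0" and loc: "\<And>u \<alpha>. norm u < \<epsilon> \<Longrightarrow>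
      g (y + u) \<le> ereal (G + \<alpha>) \<longleftrightarrow> (\<forall>l\<in>?C. l \<bullet> u \<le> \<alpha>)"
    using polyhedral_fun_local(2)[OF assms] unfolding G_def by blast
  have "subdifferential g z = {l \<in> ?C. \<forall>m\<in>?C. m \<bullet> (z - y) \<le> l \<bullet> (z - y)}" if z: "norm (z - y) < \<epsilon>" for z
  proof (intro equalityI subsetI)
    fix l assume l: "l \<in> subdifferential g z"
    define H where "H = real_of_ereal (g z)"
    have gz: "g z = ereal H" using l unfolding sub H_def by (auto simp: ereal_real')
    have lz: "H + l \<bullet> (w - z) \<le> \<beta>" if "g w \<le> ereal \<beta>" for w \<beta>
      using l that unfolding sub H_def by blast
    have m: "m \<bullet> (z - y) \<le> H - G" if "m \<in> ?C" for m
    proof -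
      have "real_of_ereal (g y) + m \<bullet> (z - y) \<le> H" using that gz unfolding sub by auto
      then show ?thesis using gy by simp
    qed
    have "l \<in> ?C"
      unfolding sub
    proof (intro conjI allI impI y)
      fix w \<beta> assume w: "g w \<le> ereal \<beta>"
      \<comment> \<open>Move from \<open>z\<close> by a small multiple \<tau> of
        \<open>w - y\<close>: the local formula bounds \<open>g\<close> there by
        \<open>H + \<tau> * (\<beta> - G)\<close>, and the subgradient inequality at
        \<open>z\<close>, divided by \<tau>, is the one wanted at \<open>y\<close>.\<close>
      define u where "u = z - y"
      have "(\<lambda>\<tau>. norm (u + \<tau> *\<^sub>R (w - y))) \<midarrow>0\<rightarrow> norm (u + 0 *\<^sub>R (w - y))"
        by (intro tendsto_intros)
      then have "\<forall>\<^sub>F \<tau> in at 0. norm (u + \<tau> *\<^sub>R (w - y)) < \<epsilon>"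
        using z by (intro order_tendstoD(2)) (auto simp: u_def)
      then obtain d where d: "d > 0" "\<And>\<tau>. \<tau> \<noteq> 0 \<Longrightarrow> \<bar>\<tau>\<bar> < d \<Longrightarrow> norm (u + \<tau> *\<^sub>R (w - y)) < \<epsilon>"
        unfolding eventually_at by (auto simp: dist_real_def)
      define \<tau> where "\<tau> = d / 2"
      have \<tau>: "\<tau> > 0" "norm (u + \<tau> *\<^sub>R (w - y)) < \<epsilon>" using d by (auto simp: \<tau>_def)
      have "\<forall>m\<in>?C. m \<bullet> (u + \<tau> *\<^sub>R (w - y)) \<le> (H - G) + \<tau> * (\<beta> - G)"
      proof
        fix m' assume m': "m' \<in> ?C"
        then have "m' \<bullet> (w - y) \<le> \<beta> - G" using w unfolding sub G_def by force
        then have "\<tau> * (m' \<bullet> (w - y)) \<le> \<tau> * (\<beta> - G)" using \<tau> by simp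
        then show "m' \<bullet> (u + \<tau> *\<^sub>R (w - y)) \<le> (H - G) + \<tau> * (\<beta> - G)"
          using m[OF m'] by (simp add: u_def inner_add_right)
      qed
      then have "g (y + (u + \<tau> *\<^sub>R (w - y))) \<le> ereal (G + ((H - G) + \<tau> * (\<beta> - G)))"
        using loc[OF \<tau>(2)] by blast
      from lz[OF this] have "\<tau> * (l \<bullet> (w - y)) \<le> \<tau> * (\<beta> - G)"
        by (simp add: u_def algebra_simps inner_add_right)
      then show "real_of_ereal (g y) + l \<bullet> (w - y) \<le> \<beta>" using \<tau>(1) by (simp add: G_def)
    qed
    moreover have "H - G \<le> l \<bullet> (z - y)"
      using lz[of y G] gy by (simp add: inner_diff_right)
    ultimately show "l \<in> {l \<in> ?C. \<forall>m\<in>?C. m \<bullet> (z - y) \<le> l \<bullet> (z - y)}"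
      using m by force
  next
    fix l assume l: "l \<in> {l \<in> ?C. \<forall>m\<in>?C. m \<bullet> (z - y) \<le> l \<bullet> (z - y)}"
    then have le: "g z \<le> ereal (G + l \<bullet> (z - y))"
      using loc[OF z, of "l \<bullet> (z - y)"] by simp
    moreover have "g z \<noteq> -\<infinity>" using g by (auto simp: polyhedral_fun_def proper_fun_def)
    ultimately have fin: "\<bar>g z\<bar> \<noteq> \<infinity>" by (cases "g z") auto
    then have "real_of_ereal (g z) \<le> G + l \<bullet> (z - y)" using le by (cases "g z") auto
    moreover have "G + l \<bullet> (w - y) \<le> \<beta>" if "g w \<le> ereal \<beta>" for w \<beta>
      using l that unfolding sub G_def by blast
    ultimately have "real_of_ereal (g z) + l \<bullet> (w - z) \<le> \<beta>" if "g w \<le> ereal \<beta>" for w \<beta>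
      using that by (fastforce simp: inner_diff_right)
    then show "l \<in> subdifferential g z" unfolding sub using fin by blast
  qed
  then show ?thesis using that \<epsilon> by blast
qed

section \<open>Relative interiors and solvability of smooth equations\<close>

text \<open>The linear space parallel to the affine hull of \<open>C\<close>, written without a base
  point; it is \<open>{0}\<close> when \<open>C\<close> is empty or a singleton.\<close>

definition direction_space :: "'a::real_vector set \<Rightarrow> 'a set" where
  "direction_space C = span {a - b |a b. a \<in> C \<and> b \<in> C}"

lemma subspace_direction_space: "subspace (direction_space C)"
  by (simp add: direction_space_def)

lemma diff_in_direction_space: "a \<in> C \<Longrightarrow> b \<in> C \<Longrightarrow> a - b \<in> direction_space C"
  unfolding direction_space_def by (rule span_base) blast

lemma rel_interior_translate:
  assumes "l \<in> rel_interior C"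
  obtains e where "e > 0" "\<And>s. s \<in> direction_space C \<Longrightarrow> norm s < e \<Longrightarrow> l + s \<in> C"
proof -
  obtain e where l: "l \<in> C" and e: "e > 0" "ball l e \<inter> affine hull C \<subseteq> C"
    using assms unfolding mem_rel_interior_ball by blast
  have "l + s \<in> affine hull C" if "s \<in> direction_space C" for s
  proof -
    have "a - b \<in> span {x - l |x. x \<in> C - {l}}" if "a \<in> C" "b \<in> C" for a b
    proof -
      have "x - l \<in> span {x - l |x. x \<in> C - {l}}" if "x \<in> C" for x
        using that by (cases "x = l") (auto intro: span_zero span_base)
      from span_diff[OF this[OF that(1)] this[OF that(2)]] show ?thesis by simp
    qed
    then have "direction_space C \<subseteq> span {x - l |x. x \<in> C - {l}}"
      unfolding direction_space_def by (intro span_minimal) auto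
    then show ?thesis
      using that unfolding affine_hull_span[OF l] by blast
  qed
  then show ?thesis using e by (intro that[of e]) (auto simp: dist_norm)
qed

text \<open>From a relative interior point one can move a little along both \<open>s\<close> and
  \<open>-s\<close>, so neither may increase the pairing with \<open>u\<close>.\<close>

lemma rel_interior_maximizer:
  assumes l: "l \<in> rel_interior C" and max: "\<And>m. m \<in> C \<Longrightarrow> m \<bullet> u \<le> l \<bullet> u"
    and s: "s \<in> direction_space C"
  shows "s \<bullet> u = 0"
proof -
  obtain e where e: "e > 0" "\<And>s. s \<in> direction_space C \<Longrightarrow> norm s < e \<Longrightarrow> l + s \<in> C"
    using rel_interior_translate[OF l] by blast
  have *: "r \<bullet> u \<le> 0" if r: "r \<in> direction_space C" for r
  proof -
    define N where "N = norm r + 1"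
    define \<tau> where "\<tau> = e / (2 * N)"
    have n: "N > 0" unfolding N_def by (smt (verit) norm_ge_zero)
    then have \<tau>: "\<tau> > 0" using e by (simp add: \<tau>_def)
    have "\<tau> * N = e / 2" using n by (simp add: \<tau>_def)
    then have "\<tau> * (norm r + 1) = e / 2" unfolding N_def .
    then have "norm (\<tau> *\<^sub>R r) < e" using \<tau> e(1) by (simp add: algebra_simps)
    then have "l + \<tau> *\<^sub>R r \<in> C"
      using r by (intro e(2) subspace_scale[OF subspace_direction_space])
    from max[OF this] show ?thesis using \<tau> by (simp add: inner_add_left mult_le_0_iff)
  qed
  from *[OF s] *[OF subspace_neg[OF subspace_direction_space s]] show ?thesis by simp
qed

text \<open>The relative interior is relatively open: one open set \<open>T\<close> witnesses
  membership for \<open>l\<close> and for all late terms of the sequence.\<close>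

lemma rel_interior_eventually:
  assumes "l \<in> rel_interior C" "m \<longlonglongrightarrow> l" "\<forall>\<^sub>F k in sequentially. m k \<in> C"
  shows "\<forall>\<^sub>F k in sequentially. m k \<in> rel_interior C"
proof -
  obtain T where T: "open T" "l \<in> T" "T \<inter> affine hull C \<subseteq> C"
    using assms(1) unfolding mem_rel_interior by blast
  have "\<forall>\<^sub>F k in sequentially. m k \<in> T"
    using topological_tendstoD[OF assms(2) T(1,2)] .
  with assms(3) show ?thesis
    by eventually_elim (use T in \<open>auto simp: mem_rel_interior\<close>)
qed

lemma rel_interior_sequence:
  fixes C :: "'a::euclidean_space set"
  assumes "convex C" "l \<in> C"
  obtains m where "\<And>k::nat. m k \<in> rel_interior C" "m \<longlonglongrightarrow> l"
proof -
  have "l \<in> closure (rel_interior C)"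
    using assms closure_subset convex_closure_rel_interior by blast
  then show ?thesis using that unfolding closure_sequential by blast
qed

text \<open>Graph points near a relative interior multiplier again carry relative interior
  multipliers, so their base points differ from \<open>y\<close> by vectors orthogonal to the
  direction space; hence \<open>(s, 0)\<close> is a regular normal there. The same vector serves for
  all multipliers in a sequence tending to \<open>l\<close>.\<close>

lemma direction_space_subset_coderivative:
  fixes g :: "'b::euclidean_space \<Rightarrow> ereal"
  assumes g: "polyhedral_fun g" and l: "l \<in> subdifferential g y"
    and s: "s \<in> direction_space (subdifferential g y)"
  shows "s \<in> coderivative (subdifferential g) y l 0"
proof -
  let ?C = "subdifferential g y"
  have conv: "convex (epi g)" by (rule polyhedral_fun_convex[OF g])
  have fin: "\<bar>g y\<bar> \<noteq> \<infinity>" using l by (simp add: subdifferential_def)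
  obtain \<epsilon> where \<epsilon>: "\<epsilon> > 0" and near: "\<And>z. norm (z - y) < \<epsilon> \<Longrightarrow> subdifferential g z =
       {l \<in> ?C. \<forall>m\<in>?C. m \<bullet> (z - y) \<le> l \<bullet> (z - y)}"
    using polyhedral_subdifferential_nearby[OF g fin] by blast
  obtain m where m: "\<And>k::nat. m k \<in> rel_interior ?C" "m \<longlonglongrightarrow> l"
    using rel_interior_sequence[OF convex_subdifferential[OF conv] l] by blast
  have reg: "(s, 0) \<in> regular_normal_cone (gph (subdifferential g)) (y, m k)" for k
  proof (rule regular_normalI)
    fix w assume "w \<in> tangent_cone (gph (subdifferential g)) (y, m k)"
    then obtain t u where tu: "\<And>j::nat. t j > (0::real)" "t \<longlonglongrightarrow> 0" "u \<longlonglongrightarrow> w"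
        "\<And>j. (y, m k) + t j *\<^sub>R u j \<in> gph (subdifferential g)"
      by (rule tangent_coneE) blast
    define z where "z j = y + t j *\<^sub>R fst (u j)" for j
    define n where "n j = m k + t j *\<^sub>R snd (u j)" for j
    have "z \<longlonglongrightarrow> y" "n \<longlonglongrightarrow> m k"
      unfolding z_def n_def
      by (rule tangent_base_tendsto[OF tu(2) tendsto_fst[OF tu(3)]])
        (rule tangent_base_tendsto[OF tu(2) tendsto_snd[OF tu(3)]])
    have n: "n j \<in> subdifferential g (z j)" for j
      using tu(4)[of j] by (cases "u j") (simp add: gph_def z_def n_def)
    have zev: "\<forall>\<^sub>F j in sequentially. norm (z j - y) < \<epsilon>"
      using tendstoD[OF \<open>z \<longlonglongrightarrow> y\<close> \<epsilon>] by (simp add: dist_norm)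
    then have "\<forall>\<^sub>F j in sequentially. n j \<in> ?C"
      by eventually_elim (use n near in blast)
    then have "\<forall>\<^sub>F j in sequentially. n j \<in> rel_interior ?C"
      by (rule rel_interior_eventually[OF m(1) \<open>n \<longlonglongrightarrow> m k\<close>])
    with zev have "\<forall>\<^sub>F j in sequentially. s \<bullet> fst (u j) = 0"
    proof eventually_elim
      fix j assume j: "norm (z j - y) < \<epsilon>" "n j \<in> rel_interior ?C"
      have "s \<bullet> (z j - y) = 0"
        using n[of j] near[OF j(1)] by (intro rel_interior_maximizer[OF j(2) _ s]) auto
      then show "s \<bullet> fst (u j) = 0" using tu(1)[of j] by (simp add: z_def)
    qed
    from tendsto_eventually[OF this] have "s \<bullet> fst w = 0"
      by (rule LIMSEQ_unique[rotated]) (intro tendsto_intros tu)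
    then show "(s, 0) \<bullet> w \<le> 0" by (cases w) simp
  qed
  have "(s, 0) \<in> limiting_normal_cone (gph (subdifferential g)) (y, l)"
  proof (rule limiting_normalI[of "\<lambda>k. (y, m k)" _ "\<lambda>k. (s, 0)"])
    show "\<forall>\<^sub>F k in sequentially. (y, m k) \<in> gph (subdifferential g)
        \<and> (s, 0) \<in> regular_normal_cone (gph (subdifferential g)) (y, m k)"
      using reg m(1) rel_interior_subset by (intro always_eventually) (auto simp: gph_def)
  qed (intro tendsto_intros m)+
  then show ?thesis by (simp add: coderivative_def)
qed

section \<open>Adjoints of bounded operators\<close>

lemma adjoint_blinfun_inner:
  fixes T :: "'a::euclidean_space \<Rightarrow>\<^sub>L 'b::euclidean_space"
  shows "adjoint (blinfun_apply T) l \<bullet> w = l \<bullet> T w"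
  by (rule adjoint_clauses(2)) (rule bounded_linear.linear[OF blinfun.bounded_linear_right])

lemma linear_adjoint_blinfun:
  fixes T :: "'a::euclidean_space \<Rightarrow>\<^sub>L 'b::euclidean_space"
  shows "linear (adjoint (blinfun_apply T))"
  by (rule adjoint_linear) (rule bounded_linear.linear[OF blinfun.bounded_linear_right])

lemma adjoint_blinfun_sum:
  fixes T :: "'a::euclidean_space \<Rightarrow>\<^sub>L 'b::euclidean_space"
  shows "adjoint (blinfun_apply T) l = (\<Sum>b\<in>Basis. (l \<bullet> T b) *\<^sub>R b)"
proof -
  have "adjoint (blinfun_apply T) l = (\<Sum>b\<in>Basis. (adjoint (blinfun_apply T) l \<bullet> b) *\<^sub>R b)"
    by (rule euclidean_representation[symmetric])
  then show ?thesis unfolding adjoint_blinfun_inner .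
qed

lemma tendsto_adjoint_blinfun:
  fixes T :: "'i \<Rightarrow> 'a::euclidean_space \<Rightarrow>\<^sub>L 'b::euclidean_space"
  assumes "(T \<longlongrightarrow> T') F" "(l \<longlongrightarrow> l') F"
  shows "((\<lambda>k. adjoint (blinfun_apply (T k)) (l k)) \<longlongrightarrow> adjoint (blinfun_apply T') l') F"
  unfolding adjoint_blinfun_sum by (intro tendsto_intros assms)

lemma norm_adjoint_blinfun:
  fixes T :: "'a::euclidean_space \<Rightarrow>\<^sub>L 'b::euclidean_space"
  shows "norm (adjoint (blinfun_apply T) l) \<le> norm T * norm l"
proof -
  let ?a = "adjoint (blinfun_apply T) l"
  have "norm ?a * norm ?a = l \<bullet> T ?a"
    using adjoint_blinfun_inner[of T l ?a] by (metis power2_norm_eq_inner power2_eq_square)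
  also have "\<dots> \<le> norm l * norm (T ?a)" by (rule norm_cauchy_schwarz)
  also have "\<dots> \<le> norm l * (norm T * norm ?a)" by (intro mult_left_mono norm_blinfun) auto
  finally have "norm ?a * norm ?a \<le> (norm T * norm l) * norm ?a" by (simp add: algebra_simps)
  then show ?thesis by (cases "norm ?a = 0") auto
qed

section \<open>Solving smooth equations along a subspace\<close>

lemma orthogonal_projection_exists:
  fixes S :: "'a::euclidean_space set"
  assumes S: "subspace S"
  obtains P where "linear P" "\<And>y. P y \<in> S" "\<And>s y. s \<in> S \<Longrightarrow> s \<bullet> P y = s \<bullet> y"
proof -
  obtain B where B: "B \<subseteq> S" "pairwise orthogonal B" "\<And>x. x \<in> B \<Longrightarrow> norm x = 1" "independent B" "span B = S"
    by (rule orthonormal_basis_subspace[OF S]) (rule that)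
  have fin: "finite B" using B(4) by (rule independent_imp_finite)
  define P where "P y = (\<Sum>b\<in>B. (b \<bullet> y) *\<^sub>R b)" for y
  have "linear P"
    unfolding P_def by (rule linearI) (simp_all add: inner_add_right scaleR_add_left sum.distrib scaleR_sum_right)
  moreover have "P y \<in> S" for y
    unfolding P_def using B(1) S by (intro subspace_sum subspace_scale) auto
  moreover have "s \<bullet> P y = s \<bullet> y" if "s \<in> S" for s y
  proof -
    have b: "b \<bullet> P y = b \<bullet> y" if "b \<in> B" for b
    proof -
      have "b \<bullet> P y = (\<Sum>c\<in>B. if c = b then b \<bullet> y else 0)"
        unfolding P_def inner_sum_right
      proof (rule sum.cong[OF refl])
        fix c assume c: "c \<in> B"
        have "b \<bullet> b = 1" using B(3)[OF that] by (simp add: norm_eq_1)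
        then show "b \<bullet> (c \<bullet> y) *\<^sub>R c = (if c = b then b \<bullet> y else 0)"
          using B(2) c that by (auto simp: pairwise_def orthogonal_def)
      qed
      then show ?thesis using that fin by simp
    qed
    have "subspace {s. s \<bullet> P y = s \<bullet> y}"
      by (auto simp: subspace_def inner_add_left)
    then have "span B \<subseteq> {s. s \<bullet> P y = s \<bullet> y}"
      using b by (intro span_minimal) auto
    then show ?thesis using that B(5) by blast
  qed
  ultimately show ?thesis using that by blast
qed

text \<open>The compression to \<open>S\<close> of \<open>A\<close> composed with its adjoint is
  injective, because \<open>s \<bullet> A (adjoint A s)\<close> is the squared norm of
  \<open>adjoint A s\<close>. Its inverse, followed by the adjoint, inverts \<open>A\<close> as far
  as vectors of \<open>S\<close> can see.\<close>

lemma projected_right_inverse: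
  fixes A :: "'a::euclidean_space \<Rightarrow> 'b::euclidean_space"
  assumes A: "linear A" and S: "subspace S" and inj: "\<And>s. s \<in> S \<Longrightarrow> (\<And>w. s \<bullet> A w = 0) \<Longrightarrow> s = 0"
  obtains B where "linear B" "\<And>y s. s \<in> S \<Longrightarrow> s \<bullet> A (B y) = s \<bullet> y"
proof -
  obtain P where P: "linear P" "\<And>y. P y \<in> S" and PS: "\<And>s y. s \<in> S \<Longrightarrow> s \<bullet> P y = s \<bullet> y"
    using orthogonal_projection_exists[OF S] by blast
  interpret P: linear P by (rule P(1))
  interpret A: linear A by (rule A)
  interpret adj: linear "adjoint A" by (rule adjoint_linear[OF A])
  \<comment> \<open>The summand \<open>y - P y\<close> takes care of the orthogonal complement of
    \<open>S\<close>, so that injectivity of the compression becomes invertibility on the whole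
    space.\<close>
  define M where "M y = P (A (adjoint A (P y))) + (y - P y)" for y
  have M: "linear M"
    unfolding M_def
    by (rule linearI) (simp_all add: P.add A.add adj.add P.scale A.scale adj.scale algebra_simps)
  have "inj M"
    unfolding linear_injective_0[OF M]
  proof (intro allI impI)
    fix y assume My: "M y = 0"
    define p where "p = P (A (adjoint A (P y)))"
    have pS: "p \<in> S" using P(2) by (simp add: p_def)
    have "p \<bullet> (y - P y) = 0" using PS[OF pS, of y] by (simp add: inner_diff_right)
    moreover have eq: "y - P y = - p"
      using My by (simp add: M_def p_def add_eq_0_iff)
    ultimately have "p = 0" by simp
    then have y: "y = P y" using eq by simp
    then have yS: "y \<in> S" using P(2) by metis
    have "adjoint A y \<bullet> adjoint A y = y \<bullet> A (adjoint A y)"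
      by (simp add: adjoint_clauses[OF A] inner_commute)
    also have "\<dots> = y \<bullet> p" using PS[OF yS] y by (metis p_def)
    finally have "adjoint A y = 0" using \<open>p = 0\<close> by simp
    then have "y \<bullet> A w = 0" for w
      using adjoint_clauses(2)[OF A, of y w] by simp
    then show "y = 0" using inj yS by blast
  qed
  then obtain M' where M': "linear M'" "\<And>x. M (M' x) = x"
    using linear_injective_isomorphism[OF M] by blast
  define B where "B y = adjoint A (P (M' y))" for y
  have "linear B"
    unfolding B_def using linear_compose[OF linear_compose[OF M'(1) P(1)] adjoint_linear[OF A]]
    by (simp add: o_def)
  moreover have "s \<bullet> A (B y) = s \<bullet> y" if s: "s \<in> S" for s y
  proof -
    have "s \<bullet> y = s \<bullet> M (M' y)" using M'(2) by simp
    also have "\<dots> = s \<bullet> P (A (B y)) + s \<bullet> (M' y - P (M' y))"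
      by (simp only: M_def B_def inner_add_right)
    also have "\<dots> = s \<bullet> A (B y)"
      using PS[OF s] by (simp add: inner_diff_right)
    finally show ?thesis by simp
  qed
  ultimately show ?thesis using that by blast
qed

text \<open>A Lyusternik-type theorem assuming differentiability at one point only. The correction
  \<open>\<eta>\<close> is a fixed point supplied by Brouwer's theorem.\<close>

lemma tangent_path_step:
  fixes \<Phi> :: "'a::euclidean_space \<Rightarrow> 'b::euclidean_space"
  assumes U: "open U" "x \<in> U" and cont: "continuous_on U \<Phi>" and der: "(\<Phi> has_derivative A) (at x)"
    and S: "subspace S" and inj: "\<And>s. s \<in> S \<Longrightarrow> (\<And>w. s \<bullet> A w = 0) \<Longrightarrow> s = 0" and e: "e > 0"
  obtains t u where "0 < t" "t < e" "norm (u - w) < e"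
    "\<And>s. s \<in> S \<Longrightarrow> s \<bullet> (\<Phi> (x + t *\<^sub>R u) - \<Phi> x - t *\<^sub>R A w) = 0"
proof -
  have A: "linear A" using der by (rule has_derivative_linear)
  interpret A: linear A by (rule A)
  obtain P where P: "linear P" "\<And>y. P y \<in> S" and PS: "\<And>s y. s \<in> S \<Longrightarrow> s \<bullet> P y = s \<bullet> y"
    using orthogonal_projection_exists[OF S] by blast
  interpret P: linear P by (rule P(1))
  have norm_P: "norm (P y) \<le> norm y" for y
  proof -
    have "norm (P y) * norm (P y) = P y \<bullet> y"
      using PS[OF P(2)[of y], of y] by (metis power2_norm_eq_inner power2_eq_square)
    also have "\<dots> \<le> norm (P y) * norm y" by (rule norm_cauchy_schwarz)
    finally show ?thesis by (cases "norm (P y) = 0") auto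
  qed
  have P0: "P y = 0" if "\<And>s. s \<in> S \<Longrightarrow> s \<bullet> y = 0" for y
    using PS[OF P(2)[of y], of y] that[OF P(2)] by simp
  have P_id: "P y = y" if "y \<in> S" for y
  proof -
    have "P y - y \<in> S" using P(2) that S subspace_diff by blast
    from PS[OF this, of y] have "(P y - y) \<bullet> (P y - y) = 0" by (simp add: inner_diff_right)
    then show ?thesis by simp
  qed
  obtain B where B: "linear B" and AB: "\<And>y s. s \<in> S \<Longrightarrow> s \<bullet> A (B y) = s \<bullet> y"
    using projected_right_inverse[OF A S inj] by blast
  interpret B: linear B by (rule B)
  obtain K where K: "K > 0" "\<And>y. norm (B y) \<le> K * norm y"
    using linear_bounded_pos[OF B] by blast
  \<comment> \<open>The correction will have norm at most \<open>\<delta> * t\<close>, so it shifts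
    the direction by at most \<open>K * \<delta> = e / 2\<close>.\<close>
  define \<delta> where "\<delta> = e / (2 * K)"
  have \<delta>: "\<delta> > 0" "K * \<delta> < e" using K(1) e by (auto simp: \<delta>_def)
  \<comment> \<open>\<open>t * Q\<close> dominates every trial displacement with \<eta> in
    \<open>Z\<close>; linearising with accuracy \<open>\<delta> / Q\<close> keeps the remainder
    within \<open>\<delta> * t\<close>, the radius of \<open>Z\<close>.\<close>
  define Q where "Q = norm w + K * \<delta> + 1"
  have Q: "Q > 0" unfolding Q_def using K \<delta> by (smt (verit) norm_ge_zero mult_pos_pos)
  obtain r where r: "r > 0" "ball x r \<subseteq> U" using U open_contains_ball by blast
  obtain d where d: "d > 0" and lin: "\<And>h. norm h < d \<Longrightarrow> norm (\<Phi> (x + h) - \<Phi> x - A h) \<le> (\<delta> / Q) * norm h"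
  proof -
    have "\<delta> / Q > 0" using \<delta> Q by simp
    then obtain d where "d > 0" "\<And>y. norm (y - x) < d \<Longrightarrow> norm (\<Phi> y - \<Phi> x - A (y - x)) \<le> (\<delta> / Q) * norm (y - x)"
      using der unfolding has_derivative_at_alt by blast
    then show ?thesis using that[of d] by (metis add_diff_cancel_left')
  qed
  define c where "c = min r d / Q"
  define t where "t = min e c / 2"
  have t: "t > 0" "t < e" "t * Q < r" "t * Q < d"
  proof -
    have "c > 0" using r d Q by (simp add: c_def)
    then show t0: "t > 0" "t < e" using e by (auto simp: t_def)
    have "t < min r d / Q" using \<open>c > 0\<close> e unfolding c_def[symmetric] by (auto simp: t_def min_def)
    then show "t * Q < r" "t * Q < d" using Q by (simp_all add: pos_less_divide_eq)
  qed
  \<comment> \<open>\<open>D \<eta>\<close> is the defect of the equation. A fixed point of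
    \<open>P (\<eta> - D \<eta>)\<close> lies in \<open>S\<close>, where \<open>P\<close> is the
    identity, so there the projected defect vanishes.\<close>
  define D where "D \<eta> = \<Phi> (x + (t *\<^sub>R w + B \<eta>)) - \<Phi> x - t *\<^sub>R A w" for \<eta>
  define Z where "Z = S \<inter> cball 0 (\<delta> * t)"
  have hb: "norm (t *\<^sub>R w + B \<eta>) \<le> t * Q" if "\<eta> \<in> Z" for \<eta>
  proof -
    have "norm (t *\<^sub>R w + B \<eta>) \<le> norm (t *\<^sub>R w) + norm (B \<eta>)" by (rule norm_triangle_ineq)
    also have "\<dots> \<le> t * norm w + K * (\<delta> * t)"
    proof (rule add_mono)
      show "norm (t *\<^sub>R w) \<le> t * norm w" using t by simp
      have "norm (B \<eta>) \<le> K * norm \<eta>" by (rule K(2))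
      also have "\<dots> \<le> K * (\<delta> * t)" using that K(1) by (intro mult_left_mono) (auto simp: Z_def)
      finally show "norm (B \<eta>) \<le> K * (\<delta> * t)" .
    qed
    also have "\<dots> \<le> t * Q" using t by (simp add: Q_def algebra_simps)
    finally show ?thesis .
  qed
  obtain \<eta> where \<eta>: "\<eta> \<in> Z" "P (\<eta> - D \<eta>) = \<eta>"
  proof (rule brouwer[of Z "\<lambda>\<eta>. P (\<eta> - D \<eta>)"])
    show "compact Z" unfolding Z_def using closed_subspace[OF S] by (simp add: closed_Int_compact)
    show "convex Z" unfolding Z_def using subspace_imp_convex[OF S] by (simp add: convex_Int)
    show "Z \<noteq> {}" using \<delta> t subspace_0[OF S] by (auto simp: Z_def)
    have bP: "continuous_on V P" and bB: "continuous_on V' B" for V V'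
      using P(1) B by (auto intro: linear_continuous_on linear_conv_bounded_linear[THEN iffD1])
    have "continuous_on Z (\<lambda>\<eta>. \<Phi> (x + (t *\<^sub>R w + B \<eta>)))"
    proof (rule continuous_on_compose2[OF cont])
      show "continuous_on Z (\<lambda>\<eta>. x + (t *\<^sub>R w + B \<eta>))" by (intro continuous_intros bB)
      show "(\<lambda>\<eta>. x + (t *\<^sub>R w + B \<eta>)) ` Z \<subseteq> U"
      proof (rule image_subsetI)
        fix \<eta> assume "\<eta> \<in> Z"
        then have "norm (t *\<^sub>R w + B \<eta>) < r" using hb t by fastforce
        then have "x + (t *\<^sub>R w + B \<eta>) \<in> ball x r"
          by (simp only: mem_ball dist_commute[of x]) (simp add: dist_norm)
        then show "x + (t *\<^sub>R w + B \<eta>) \<in> U" using r by blast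
      qed
    qed
    then have "continuous_on Z (\<lambda>\<eta>. \<eta> - D \<eta>)"
      unfolding D_def by (intro continuous_intros)
    then show "continuous_on Z (\<lambda>\<eta>. P (\<eta> - D \<eta>))"
      by (rule continuous_on_compose2[OF bP]) auto
    show "(\<lambda>\<eta>. P (\<eta> - D \<eta>)) \<in> Z \<rightarrow> Z"
    proof
      fix \<eta> assume \<eta>: "\<eta> \<in> Z"
      let ?h = "t *\<^sub>R w + B \<eta>"
      let ?R = "\<Phi> (x + ?h) - \<Phi> x - A ?h"
      \<comment> \<open>As \<open>B\<close> is a right inverse of \<open>A\<close> against vectors
        of \<open>S\<close>, the linear parts cancel under \<open>P\<close> and only the first-order
        remainder \<open>?R\<close> is left.\<close>
      have "\<eta> - D \<eta> = (\<eta> - A (B \<eta>)) - ?R"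
        by (simp add: D_def A.add A.scale)
      moreover have "P (\<eta> - A (B \<eta>)) = 0"
        by (rule P0) (simp add: inner_diff_right AB)
      ultimately have "norm (P (\<eta> - D \<eta>)) = norm (P ?R)"
        by (simp only: P.diff diff_0 norm_minus_cancel)
      also have "\<dots> \<le> norm ?R" by (rule norm_P)
      also have "\<dots> \<le> (\<delta> / Q) * norm ?h" using hb[OF \<eta>] t by (intro lin) simp
      also have "\<dots> \<le> (\<delta> / Q) * (t * Q)" using hb[OF \<eta>] \<delta> Q by (intro mult_left_mono) auto
      also have "\<dots> = \<delta> * t" using Q by simp
      finally show "P (\<eta> - D \<eta>) \<in> Z" using P(2) by (simp add: Z_def)
    qed
  qed (use that in blast)
  have "P \<eta> = \<eta>" using \<eta>(1) P_id by (simp add: Z_def)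
  then have "P (D \<eta>) = 0" using \<eta>(2) by (simp add: P.diff)
  then have D0: "s \<bullet> D \<eta> = 0" if "s \<in> S" for s using PS[OF that, of "D \<eta>"] by simp
  define u where "u = w + (1/t) *\<^sub>R B \<eta>"
  have tu: "t *\<^sub>R u = t *\<^sub>R w + B \<eta>" using t by (simp add: u_def algebra_simps)
  have "norm (u - w) = norm (B \<eta>) / t" using t by (simp add: u_def)
  also have "\<dots> \<le> K * \<delta>"
  proof -
    have "norm (B \<eta>) \<le> K * norm \<eta>" by (rule K(2))
    also have "\<dots> \<le> K * (\<delta> * t)" using \<eta>(1) K(1) by (intro mult_left_mono) (auto simp: Z_def)
    finally show ?thesis using t by (simp add: pos_divide_le_eq)
  qed
  finally have "norm (u - w) < e" using \<delta> by simp
  then show ?thesis using that[of t u] t D0 by (simp add: D_def tu)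
qed

text \<open>Steps with tolerance \<open>inverse (real (Suc k))\<close> are collected into a
  sequence: the error goes entirely into the direction, none into the components along
  \<open>S\<close>.\<close>

lemma tangent_path:
  fixes \<Phi> :: "'a::euclidean_space \<Rightarrow> 'b::euclidean_space"
  assumes "open U" "x \<in> U" "continuous_on U \<Phi>" "(\<Phi> has_derivative A) (at x)"
    and "subspace S" "\<And>s. s \<in> S \<Longrightarrow> (\<And>w. s \<bullet> A w = 0) \<Longrightarrow> s = 0"
  obtains t u where "\<And>k::nat. t k > (0::real)" "t \<longlonglongrightarrow> 0" "u \<longlonglongrightarrow> w"
    "\<And>k s. s \<in> S \<Longrightarrow> s \<bullet> (\<Phi> (x + t k *\<^sub>R u k) - \<Phi> x - t k *\<^sub>R A w) = 0"
proof -
  have "\<exists>t u. 0 < t \<and> t < inverse (real (Suc k)) \<and> norm (u - w) < inverse (real (Suc k)) \<and>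
      (\<forall>s\<in>S. s \<bullet> (\<Phi> (x + t *\<^sub>R u) - \<Phi> x - t *\<^sub>R A w) = 0)" for k
    by (rule tangent_path_step[OF assms, of "inverse (real (Suc k))" w]) auto
  then obtain t u where tu: "\<And>k. 0 < t k" "\<And>k. t k < inverse (real (Suc k))"
      "\<And>k. norm (u k - w) < inverse (real (Suc k))"
      "\<And>k s. s \<in> S \<Longrightarrow> s \<bullet> (\<Phi> (x + t k *\<^sub>R u k) - \<Phi> x - t k *\<^sub>R A w) = 0"
    by metis
  have "t \<longlonglongrightarrow> 0"
    using tu(1,2) by (intro tendsto_sandwich[OF _ _ tendsto_const LIMSEQ_inverse_real_of_nat])
      (auto intro!: always_eventually less_imp_le)
  moreover have "u \<longlonglongrightarrow> w"
    by (rule LIM_zero_cancel, rule tendsto_norm_zero_cancel,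
        rule tendsto_sandwich[OF _ _ tendsto_const LIMSEQ_inverse_real_of_nat])
      (use tu(3) in \<open>auto intro!: always_eventually less_imp_le\<close>)
  ultimately show ?thesis using that tu by blast
qed

section \<open>The chain rule\<close>

text \<open>A discrete product rule: the change of operator acts on the old multiplier
  \<open>l\<close>, while the change \<open>s\<close> of the multiplier is seen through the new
  operator \<open>T\<close>.\<close>

lemma adjoint_blinfun_diff_quotient:
  fixes T T' :: "'a::euclidean_space \<Rightarrow>\<^sub>L 'b::euclidean_space"
  assumes "t > (0::real)"
  shows "(adjoint (blinfun_apply T) (l + t *\<^sub>R s) - adjoint (blinfun_apply T') l) /\<^sub>R t
    = adjoint (blinfun_apply ((T - T') /\<^sub>R t)) l + adjoint (blinfun_apply T) s"
  by (rule vector_eq_rdot[THEN iffD1])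
    (use assms in \<open>simp add: inner_add_left inner_diff_left adjoint_blinfun_inner blinfun.bilinear_simps
      inner_diff_right field_simps\<close>)

text \<open>One neighbourhood \<open>U\<close> on which all the local facts hold together. SOQC is
  present through the constant \<open>c\<close>, whose bound holds at every point of
  \<open>U\<close> but for the fixed direction space taken at \<open>x\<close>; \<open>faces\<close>
  is the local polyhedral structure pulled back by \<open>\<Phi>\<close>.\<close>

locale nondegenerate_composite =
  fixes \<phi> :: "'a::euclidean_space \<Rightarrow> ereal" and g :: "'b::euclidean_space \<Rightarrow> ereal"
    and \<Phi> :: "'a \<Rightarrow> 'b" and A :: "'a \<Rightarrow> 'a \<Rightarrow>\<^sub>L 'b" and H :: "'a \<Rightarrow> 'a \<Rightarrow>\<^sub>L 'a \<Rightarrow>\<^sub>L 'b"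
    and U :: "'a set" and x :: 'a and l :: 'b and c :: real
  assumes g: "polyhedral_fun g" and U: "open U" "x \<in> U"
    and A: "\<And>y. y \<in> U \<Longrightarrow> (\<Phi> has_derivative blinfun_apply (A y)) (at y)"
    and H: "\<And>y. y \<in> U \<Longrightarrow> (A has_derivative blinfun_apply (H y)) (at y)"
    and H_cont: "continuous_on U H"
    and rep: "\<And>y. y \<in> U \<Longrightarrow> \<phi> y = g (\<Phi> y)"
    and l: "l \<in> subdifferential g (\<Phi> x)"
    and c: "c > 0" "\<And>y s. y \<in> U \<Longrightarrow> s \<in> direction_space (subdifferential g (\<Phi> x)) \<Longrightarrow>
              c * norm s \<le> norm (adjoint (blinfun_apply (A y)) s)"
    and faces: "\<And>y. y \<in> U \<Longrightarrow> subdifferential g (\<Phi> y) =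
       {l \<in> subdifferential g (\<Phi> x). \<forall>m\<in>subdifferential g (\<Phi> x). m \<bullet> (\<Phi> y - \<Phi> x) \<le> l \<bullet> (\<Phi> y - \<Phi> x)}"
begin

abbreviation C where "C \<equiv> subdifferential g (\<Phi> x)"
abbreviation S where "S \<equiv> direction_space C"
abbreviation tr where "tr y \<equiv> adjoint (blinfun_apply (A y))"
abbreviation G where "G \<equiv> gph (subdifferential \<phi>)"

section \<open>Stability of multipliers\<close>

lemma conv: "convex (epi g)"
  by (rule polyhedral_fun_convex[OF g])

lemma \<Phi>_cont: "continuous_on U \<Phi>"
  using A by (meson has_derivative_at_withinI has_derivative_continuous_on)

lemma A_cont: "continuous_on U A"
  using H by (meson has_derivative_at_withinI has_derivative_continuous_on)

lemma sub_C: "y \<in> U \<Longrightarrow> subdifferential g (\<Phi> y) \<subseteq> C"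
  using faces by blast

lemma diff_S: "a \<in> C \<Longrightarrow> b \<in> C \<Longrightarrow> a - b \<in> S"
  by (rule diff_in_direction_space)

lemma tr_diff: "tr y (a - b) = tr y a - tr y b"
  by (rule linear_diff[OF linear_adjoint_blinfun])

lemma tr_inj: "y \<in> U \<Longrightarrow> s \<in> S \<Longrightarrow> tr y s = 0 \<Longrightarrow> s = 0"
  using c(2)[of y s] c(1) by (simp add: mult_le_0_iff)

lemma A_inj:
  assumes "y \<in> U" "s \<in> S" "\<And>w. s \<bullet> A y w = 0"
  shows "s = 0"
proof (rule tr_inj[OF assms(1,2)])
  have "tr y s \<bullet> tr y s = 0" using assms(3) by (simp only: adjoint_blinfun_inner)
  then show "tr y s = 0" by simp
qed

lemma tendsto_at: "y' \<in> U \<Longrightarrow> (y \<longlongrightarrow> y') F \<Longrightarrow> ((\<lambda>k. \<Phi> (y k)) \<longlongrightarrow> \<Phi> y') F"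
  "y' \<in> U \<Longrightarrow> (y \<longlongrightarrow> y') F \<Longrightarrow> ((\<lambda>k. A (y k)) \<longlongrightarrow> A y') F"
  "y' \<in> U \<Longrightarrow> (y \<longlongrightarrow> y') F \<Longrightarrow> ((\<lambda>k. H (y k)) \<longlongrightarrow> H y') F"
  using \<Phi>_cont A_cont H_cont U(1) by (auto intro: isCont_tendsto_compose simp: continuous_on_eq_continuous_at)

lemma eventually_U: "y' \<in> U \<Longrightarrow> (y \<longlongrightarrow> y') F \<Longrightarrow> \<forall>\<^sub>F k in F. y k \<in> U"
  using topological_tendstoD U(1) by blast

text \<open>Differences of multipliers lie in \<open>S\<close>, where the lower bound
  \<open>c\<close> does not depend on the base point, so convergence of the images controls the
  multipliers themselves.\<close>

lemma multiplier_tendsto: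
  fixes y :: "nat \<Rightarrow> 'a"
  assumes y': "y' \<in> U" "y \<longlonglongrightarrow> y'" and m: "\<forall>\<^sub>F k in sequentially. m k \<in> C" "m' \<in> C"
    and lim: "(\<lambda>k. tr (y k) (m k)) \<longlonglongrightarrow> tr y' m'"
  shows "m \<longlonglongrightarrow> m'"
proof -
  have "(\<lambda>k. norm (tr (y k) (m k) - tr (y k) m') / c) \<longlonglongrightarrow> norm (tr y' m' - tr y' m') / c"
    using c(1) by (intro tendsto_intros lim tendsto_adjoint_blinfun tendsto_at y') auto
  then have 0: "(\<lambda>k. norm (tr (y k) (m k) - tr (y k) m') / c) \<longlonglongrightarrow> 0" by simp
  have le: "\<forall>\<^sub>F k in sequentially. norm (m k - m') \<le> norm (tr (y k) (m k) - tr (y k) m') / c"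
    using eventually_U[OF y'] m(1)
  proof eventually_elim
    case (elim k)
    then have "c * norm (m k - m') \<le> norm (tr (y k) (m k) - tr (y k) m')"
      using c(2)[of "y k" "m k - m'"] diff_S m(2) by (simp add: tr_diff)
    then show ?case using c(1) by (simp add: pos_le_divide_eq mult.commute)
  qed
  have "(\<lambda>k. norm (m k - m')) \<longlonglongrightarrow> 0"
    by (rule tendsto_sandwich[OF _ le tendsto_const 0]) simp
  then show ?thesis by (rule LIM_zero_cancel[OF tendsto_norm_zero_cancel])
qed

text \<open>Here the limit is not known in advance to be an image: the bound \<open>c\<close> keeps
  the multipliers in a compact part of \<open>C\<close>, a cluster point yields \<open>m'\<close>,
  and \<open>multiplier_tendsto\<close> upgrades the subsequence to the full sequence.\<close>

lemma multiplier_limit: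
  assumes y': "y' \<in> U" "y \<longlonglongrightarrow> y'" and y: "\<And>k::nat. y k \<in> U" and m: "\<And>k. m k \<in> C"
    and lim: "(\<lambda>k. tr (y k) (m k)) \<longlonglongrightarrow> v"
  obtains m' where "m \<longlonglongrightarrow> m'" "tr y' m' = v"
proof -
  have "(\<lambda>k. norm (tr (y k) (m k) - tr (y k) l) / c) \<longlonglongrightarrow> norm (v - tr y' l) / c"
    using c(1) by (intro tendsto_intros lim tendsto_adjoint_blinfun tendsto_at y') auto
  then have "convergent (\<lambda>k. norm (tr (y k) (m k) - tr (y k) l) / c)"
    by (rule convergentI)
  from convergent_imp_Bseq[OF this]
  obtain K where K: "\<And>k. norm (norm (tr (y k) (m k) - tr (y k) l) / c) \<le> K"
    by (elim BseqE) blast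
  have "norm (m k - l) \<le> K" for k
  proof -
    have "c * norm (m k - l) \<le> norm (tr (y k) (m k) - tr (y k) l)"
      using c(2)[OF y diff_S[OF m l], of k] by (simp add: tr_diff)
    then have "norm (m k - l) \<le> norm (tr (y k) (m k) - tr (y k) l) / c"
      using c(1) by (simp add: pos_le_divide_eq mult.commute)
    with K[of k] show ?thesis by (smt (verit) real_norm_def)
  qed
  then have "m k \<in> C \<inter> cball l K" for k
    using m by (simp add: dist_norm norm_minus_commute)
  moreover have "compact (C \<inter> cball l K)"
    by (intro closed_Int_compact closed_subdifferential conv compact_cball)
  ultimately obtain m' r where m': "m' \<in> C" and r: "strict_mono r" "(m \<circ> r) \<longlonglongrightarrow> m'"
    unfolding compact_def by (metis IntD1)
  have "(\<lambda>k. tr (y (r k)) (m (r k))) \<longlonglongrightarrow> tr y' m'"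
    using r(2) LIMSEQ_subseq_LIMSEQ[OF y'(2) r(1)]
    by (intro tendsto_adjoint_blinfun tendsto_at y') (simp_all add: o_def)
  moreover have "(\<lambda>k. tr (y (r k)) (m (r k))) \<longlonglongrightarrow> v"
    using LIMSEQ_subseq_LIMSEQ[OF lim r(1)] by (simp add: o_def)
  ultimately have v: "tr y' m' = v" by (rule LIMSEQ_unique)
  have "m \<longlonglongrightarrow> m'"
    by (rule multiplier_tendsto[OF y' _ m']) (use m lim v in auto)
  then show ?thesis using that v by blast
qed

lemma path:
  assumes "y \<in> U"
  obtains t u where "\<And>k::nat. t k > (0::real)" "t \<longlonglongrightarrow> 0" "u \<longlonglongrightarrow> w"
    "\<And>k s. s \<in> S \<Longrightarrow> s \<bullet> (\<Phi> (y + t k *\<^sub>R u k) - \<Phi> y - t k *\<^sub>R A y w) = 0"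
  by (rule tangent_path[OF U(1) assms \<Phi>_cont A[OF assms] subspace_direction_space A_inj[OF assms]])
    (use that in auto)

section \<open>Subgradients of the composition\<close>

lemma \<phi>_finite: "y \<in> U \<Longrightarrow> m \<in> subdifferential g (\<Phi> y) \<Longrightarrow> \<bar>\<phi> y\<bar> \<noteq> \<infinity>"
  by (simp add: rep subdifferential_def)

lemma chain_rule_superset:
  assumes y: "y \<in> U" and m: "m \<in> subdifferential g (\<Phi> y)"
  shows "tr y m \<in> subdifferential \<phi> y"
proof -
  define \<gamma> where "\<gamma> = real_of_ereal (\<phi> y)"
  have fin: "\<phi> y = ereal \<gamma>" using \<phi>_finite[OF y m] by (simp add: \<gamma>_def ereal_real')
  have m': "\<gamma> + m \<bullet> (z - \<Phi> y) \<le> \<beta>" if "g z \<le> ereal \<beta>" for z \<beta>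
    using m that fin unfolding subdifferential_convex[OF conv] rep[OF y, symmetric] by auto
  have e: "(y, \<gamma>) \<in> epi \<phi>" by (simp add: epi_def fin)
  have "(tr y m, -1) \<in> regular_normal_cone (epi \<phi>) (y, \<gamma>)"
  proof (rule regular_normalI)
    fix wa assume "wa \<in> tangent_cone (epi \<phi>) (y, \<gamma>)"
    then obtain t u where tu: "\<And>k::nat. t k > (0::real)" "t \<longlonglongrightarrow> 0" "u \<longlonglongrightarrow> wa"
        "\<And>k. (y, \<gamma>) + t k *\<^sub>R u k \<in> epi \<phi>"
      by (rule tangent_coneE) blast
    define z where "z k = y + t k *\<^sub>R fst (u k)" for k
    have fst_u: "(\<lambda>k. fst (u k)) \<longlonglongrightarrow> fst wa" and snd_u: "(\<lambda>k. snd (u k)) \<longlonglongrightarrow> snd wa"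
      using tu(3) by (auto intro: tendsto_intros)
    have "z \<longlonglongrightarrow> y" unfolding z_def by (rule tangent_base_tendsto[OF tu(2) fst_u])
    from eventually_U[OF y this]
    have "\<forall>\<^sub>F k in sequentially. m \<bullet> ((\<Phi> (z k) - \<Phi> y) /\<^sub>R t k) \<le> snd (u k)"
    proof eventually_elim
      case (elim k)
      have "\<phi> (z k) \<le> ereal (\<gamma> + t k * snd (u k))"
        using tu(4)[of k] by (cases "u k") (simp add: epi_def z_def)
      then have "m \<bullet> (\<Phi> (z k) - \<Phi> y) \<le> t k * snd (u k)"
        using m'[of "\<Phi> (z k)"] rep[OF elim] by fastforce
      then have "(m \<bullet> (\<Phi> (z k) - \<Phi> y)) / t k \<le> snd (u k)"
        using tu(1)[of k] by (simp add: pos_divide_le_eq mult.commute)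
      then show ?case by (simp add: divide_inverse mult.commute)
    qed
    moreover have "(\<lambda>k. m \<bullet> ((\<Phi> (z k) - \<Phi> y) /\<^sub>R t k)) \<longlonglongrightarrow> m \<bullet> A y (fst wa)"
      unfolding z_def by (intro tendsto_intros directional_limit[OF A[OF y] tu(1,2) fst_u])
    ultimately have "m \<bullet> A y (fst wa) \<le> snd wa"
      using snd_u by (intro tendsto_le[OF sequentially_bot]) auto
    then show "(tr y m, -1) \<bullet> wa \<le> 0"
      by (cases wa) (simp add: adjoint_blinfun_inner)
  qed
  then show ?thesis
    using regular_subset_limiting[OF e] fin by (auto simp: subdifferential_def)
qed

text \<open>The path controls \<open>\<Phi>\<close> only along \<open>S\<close>. The leftover
  \<open>r k\<close> is orthogonal to \<open>S\<close>, so every multiplier pairs with it as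
  \<open>l\<close> does, and shifting the last coordinate by \<open>l \<bullet> r k\<close>, which
  tends to 0, puts the path into the epigraph.\<close>

lemma epi_tangent:
  assumes y: "y \<in> U" and fin: "\<bar>\<phi> y\<bar> \<noteq> \<infinity>" and dom: "\<And>m. m \<in> subdifferential g (\<Phi> y) \<Longrightarrow> m \<bullet> A y w \<le> \<alpha>"
  shows "(w, \<alpha>) \<in> tangent_cone (epi \<phi>) (y, real_of_ereal (\<phi> y))"
proof -
  define \<gamma> where "\<gamma> = real_of_ereal (\<phi> y)"
  obtain \<epsilon> where \<epsilon>: "\<epsilon> > 0" and loc: "\<And>u \<alpha>. norm u < \<epsilon> \<Longrightarrow>
      g (\<Phi> y + u) \<le> ereal (\<gamma> + \<alpha>) \<longleftrightarrow> (\<forall>m\<in>subdifferential g (\<Phi> y). m \<bullet> u \<le> \<alpha>)"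
    using polyhedral_fun_local(2)[OF g, of "\<Phi> y"] fin unfolding \<gamma>_def rep[OF y] by blast
  obtain t u where tu: "\<And>k::nat. t k > (0::real)" "t \<longlonglongrightarrow> 0" "u \<longlonglongrightarrow> w"
    "\<And>k s. s \<in> S \<Longrightarrow> s \<bullet> (\<Phi> (y + t k *\<^sub>R u k) - \<Phi> y - t k *\<^sub>R A y w) = 0"
    using path[OF y] by blast
  define z where "z k = y + t k *\<^sub>R u k" for k
  have z: "z \<longlonglongrightarrow> y" unfolding z_def by (rule tangent_base_tendsto[OF tu(2,3)])
  define r where "r k = (\<Phi> (z k) - \<Phi> y) /\<^sub>R t k - A y w" for k
  have "r \<longlonglongrightarrow> A y w - A y w"
    unfolding r_def z_def by (intro tendsto_intros directional_limit[OF A[OF y] tu(1,2,3)])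
  then have r0: "r \<longlonglongrightarrow> 0" by simp
  have r: "\<Phi> (z k) - \<Phi> y = t k *\<^sub>R (A y w + r k)" for k
    using tu(1)[of k] by (simp add: r_def)
  have rS: "s \<bullet> r k = 0" if "s \<in> S" for s k
  proof -
    have "t k * (s \<bullet> r k) = s \<bullet> (\<Phi> (z k) - \<Phi> y - t k *\<^sub>R A y w)"
      unfolding r by (simp add: inner_add_right algebra_simps)
    then show ?thesis using tu(4)[OF that, of k] tu(1)[of k] by (simp add: z_def)
  qed
  have "\<forall>\<^sub>F k in sequentially. norm (\<Phi> (z k) - \<Phi> y) < \<epsilon>"
    using tendstoD[OF tendsto_at(1)[OF y z] \<epsilon>] by (simp add: dist_norm)
  with eventually_U[OF y z]
  have ev: "\<forall>\<^sub>F k in sequentially. (y, \<gamma>) + t k *\<^sub>R (u k, \<alpha> + l \<bullet> r k) \<in> epi \<phi>"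
  proof eventually_elim
    case (elim k)
    have "m \<bullet> (\<Phi> (z k) - \<Phi> y) \<le> t k * (\<alpha> + l \<bullet> r k)" if m: "m \<in> subdifferential g (\<Phi> y)" for m
    proof -
      have "(m - l) \<bullet> r k = 0" using m sub_C[OF y] l by (intro rS diff_S) auto
      then have "m \<bullet> (A y w + r k) \<le> \<alpha> + l \<bullet> r k"
        using dom[OF m] by (simp add: inner_add_right inner_diff_left)
      then show ?thesis unfolding r using tu(1)[of k] by simp
    qed
    then have "g (\<Phi> y + (\<Phi> (z k) - \<Phi> y)) \<le> ereal (\<gamma> + t k * (\<alpha> + l \<bullet> r k))"
      using loc[OF elim(2)] by blast
    then show ?case using rep[OF elim(1)] by (simp add: epi_def z_def)
  qed
  have "(\<lambda>k. (u k, \<alpha> + l \<bullet> r k)) \<longlonglongrightarrow> (w, \<alpha> + l \<bullet> 0)"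
    by (intro tendsto_intros tu r0)
  then show ?thesis
    using tangent_coneI[OF tu(1,2) _ ev] by (simp add: \<gamma>_def)
qed

text \<open>Linear images of unbounded closed sets need not be closed; here the bound
  \<open>c\<close> makes the preimages of a convergent sequence converge.\<close>

lemma closed_tr_image:
  assumes y: "y \<in> U" shows "closed (tr y ` subdifferential g (\<Phi> y))"
  unfolding closed_sequential_limits
proof (intro allI impI, elim conjE)
  fix f v assume "\<forall>n. f n \<in> tr y ` subdifferential g (\<Phi> y)" and f: "f \<longlonglongrightarrow> v"
  then have "\<exists>m. \<forall>n. m n \<in> subdifferential g (\<Phi> y) \<and> f n = tr y (m n)"
    by (intro choice) blast
  then obtain m where m: "\<And>n. m n \<in> subdifferential g (\<Phi> y)" "\<And>n. f n = tr y (m n)"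
    by blast
  have mC: "m n \<in> C" for n using m(1) sub_C[OF y] by blast
  have "(\<lambda>n. tr y (m n)) \<longlonglongrightarrow> v" using f unfolding m(2)[abs_def] .
  then obtain m' where m': "m \<longlonglongrightarrow> m'" "tr y m' = v"
    using multiplier_limit[of y "\<lambda>_. y" m v] y mC by auto
  have "m' \<in> subdifferential g (\<Phi> y)"
    using closed_subdifferential[OF conv] m(1) m'(1) unfolding closed_sequential_limits by blast
  then show "v \<in> tr y ` subdifferential g (\<Phi> y)" using m'(2) by blast
qed

lemma epi_regular_normal:
  assumes y: "y \<in> U" and e: "(y, a) \<in> epi \<phi>"
    and n: "(p, - \<beta>) \<in> regular_normal_cone (epi \<phi>) (y, a)" and \<beta>: "\<beta> > 0"
  shows "\<phi> y = ereal a" and "(1 / \<beta>) *\<^sub>R p \<in> tr y ` subdifferential g (\<Phi> y)"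
proof -
  have le: "\<phi> y \<le> ereal a" using e by (simp add: epi_def)
  have "\<phi> y \<noteq> - \<infinity>" using g rep[OF y] by (simp add: polyhedral_fun_def proper_fun_def)
  with le have fin: "\<bar>\<phi> y\<bar> \<noteq> \<infinity>" by (cases "\<phi> y") auto
  define \<gamma> where "\<gamma> = real_of_ereal (\<phi> y)"
  have \<gamma>: "\<phi> y = ereal \<gamma>" using fin by (simp add: \<gamma>_def ereal_real')
  show a: "\<phi> y = ereal a"
  proof (rule ccontr)
    assume "\<phi> y \<noteq> ereal a"
    then have lt: "\<gamma> < a" using le \<gamma> by simp
    \<comment> \<open>Above the graph the epigraph contains a vertical segment below the point; the
      steps divide the gap \<open>a - \<gamma>\<close> by \<open>Suc k\<close>, so the longest one
      ends on the graph.\<close>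
    have "(0, -1) \<in> tangent_cone (epi \<phi>) (y, a)"
    proof (rule tangent_coneI)
      show "(\<lambda>k. (a - \<gamma>) * inverse (real (Suc k))) \<longlonglongrightarrow> 0"
        using tendsto_mult[OF tendsto_const LIMSEQ_inverse_real_of_nat, of "a - \<gamma>"] by simp
      show "(a - \<gamma>) * inverse (real (Suc k)) > 0" for k using lt by simp
      show "\<forall>\<^sub>F k in sequentially. (y, a) + ((a - \<gamma>) * inverse (real (Suc k))) *\<^sub>R (0, -1) \<in> epi \<phi>"
      proof (intro always_eventually allI)
        fix k
        have "(a - \<gamma>) * inverse (real (Suc k)) \<le> (a - \<gamma>) * 1"
          using lt by (intro mult_left_mono) (auto simp: inverse_eq_divide)
        then show "(y, a) + ((a - \<gamma>) * inverse (real (Suc k))) *\<^sub>R (0, -1) \<in> epi \<phi>"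
          by (simp add: epi_def \<gamma>)
      qed
    qed (rule tendsto_const)
    from regular_normalD[OF n this] \<beta> show False by simp
  qed
  show "(1 / \<beta>) *\<^sub>R p \<in> tr y ` subdifferential g (\<Phi> y)"
  proof (rule ccontr)
    assume not: "\<not> ?thesis"
    have "convex (tr y ` subdifferential g (\<Phi> y))"
      by (intro convex_linear_image linear_adjoint_blinfun convex_subdifferential conv)
    \<comment> \<open>A hyperplane separating the scaled normal from the image gives, with signs
      reversed, a tangent direction of the epigraph that pairs positively with the normal.\<close>
    from separating_hyperplane_closed_point[OF this closed_tr_image[OF y] not]
    obtain w b where w: "w \<bullet> ((1 / \<beta>) *\<^sub>R p) < b" "\<And>m. m \<in> subdifferential g (\<Phi> y) \<Longrightarrow> b < w \<bullet> tr y m"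
      by blast
    have "(- w, - b) \<in> tangent_cone (epi \<phi>) (y, real_of_ereal (\<phi> y))"
    proof (rule epi_tangent[OF y fin])
      fix m assume "m \<in> subdifferential g (\<Phi> y)"
      from w(2)[OF this] have "b < m \<bullet> A y w" by (metis adjoint_blinfun_inner inner_commute)
      then show "m \<bullet> A y (- w) \<le> - b" by (simp add: blinfun.minus_right)
    qed
    then have "(- w, - b) \<in> tangent_cone (epi \<phi>) (y, a)" by (simp add: a)
    from regular_normalD[OF n this] show False using w(1) \<beta> by (simp add: inner_commute field_simps)
  qed
qed

text \<open>Limiting subgradients come from normals at points of the epigraph that could lie above
  the graph. Once the last component is negative, \<open>epi_regular_normal\<close> puts these
  points on the graph and supplies multipliers, which converge by
  \<open>multiplier_limit\<close>.\<close>

lemma chain_rule: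
  assumes y: "y \<in> U"
  shows "subdifferential \<phi> y = tr y ` subdifferential g (\<Phi> y)"
proof
  show "tr y ` subdifferential g (\<Phi> y) \<subseteq> subdifferential \<phi> y"
    using chain_rule_superset[OF y] by blast
  show "subdifferential \<phi> y \<subseteq> tr y ` subdifferential g (\<Phi> y)"
  proof
    fix v assume v: "v \<in> subdifferential \<phi> y"
    define \<gamma> where "\<gamma> = real_of_ereal (\<phi> y)"
    have fin: "\<bar>g (\<Phi> y)\<bar> \<noteq> \<infinity>" and vn: "(v, -1) \<in> limiting_normal_cone (epi \<phi>) (y, \<gamma>)"
      using v rep[OF y] by (auto simp: subdifferential_def \<gamma>_def)
    obtain e n where e: "\<And>k::nat. e k \<in> epi \<phi>" and n: "\<And>k. n k \<in> regular_normal_cone (epi \<phi>) (e k)"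
      and lim: "e \<longlonglongrightarrow> (y, \<gamma>)" "n \<longlonglongrightarrow> (v, -1)"
      using limiting_normalE[OF vn] by blast
    have lims: "(\<lambda>k. fst (e k)) \<longlonglongrightarrow> y" "(\<lambda>k. snd (e k)) \<longlonglongrightarrow> \<gamma>" "(\<lambda>k. fst (n k)) \<longlonglongrightarrow> v" "(\<lambda>k. snd (n k)) \<longlonglongrightarrow> -1"
      using tendsto_fst[OF lim(1)] tendsto_snd[OF lim(1)] tendsto_fst[OF lim(2)] tendsto_snd[OF lim(2)] by auto
    have "\<forall>\<^sub>F k in sequentially. snd (n k) < 0"
      by (rule order_tendstoD(2)[OF lims(4)]) simp
    with eventually_U[OF y lims(1)]
    have "\<forall>\<^sub>F k in sequentially. fst (e k) \<in> U \<and> snd (n k) < 0" by eventually_elim simp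
    then obtain N where N: "\<And>k. k \<ge> N \<Longrightarrow> fst (e k) \<in> U \<and> snd (n k) < 0"
      by (auto simp: eventually_sequentially)
    define z where "z k = fst (e (k + N))" for k
    have zU: "z k \<in> U" for k using N by (simp add: z_def)
    have z: "z \<longlonglongrightarrow> y" unfolding z_def by (rule LIMSEQ_ignore_initial_segment[OF lims(1)])
    have reg: "\<phi> (z k) = ereal (snd (e (k + N)))"
      "(1 / - snd (n (k + N))) *\<^sub>R fst (n (k + N)) \<in> tr (z k) ` subdifferential g (\<Phi> (z k))" for k
    proof -
      have "(z k, snd (e (k + N))) \<in> epi \<phi>" "- snd (n (k + N)) > 0"
        "(fst (n (k + N)), - (- snd (n (k + N)))) \<in> regular_normal_cone (epi \<phi>) (z k, snd (e (k + N)))"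
        using e n N by (auto simp: z_def)
      from epi_regular_normal[OF zU this(1,3,2)]
      show "\<phi> (z k) = ereal (snd (e (k + N)))"
        "(1 / - snd (n (k + N))) *\<^sub>R fst (n (k + N)) \<in> tr (z k) ` subdifferential g (\<Phi> (z k))" .
    qed
    have "\<exists>m. \<forall>k. m k \<in> subdifferential g (\<Phi> (z k)) \<and>
        (1 / - snd (n (k + N))) *\<^sub>R fst (n (k + N)) = tr (z k) (m k)"
      by (intro choice) (use reg(2) in blast)
    then obtain m where m: "\<And>k. m k \<in> subdifferential g (\<Phi> (z k))"
        "\<And>k. (1 / - snd (n (k + N))) *\<^sub>R fst (n (k + N)) = tr (z k) (m k)"
      by blast
    have "(\<lambda>k. (1 / - snd (n (k + N))) *\<^sub>R fst (n (k + N))) \<longlonglongrightarrow> (1 / - (-1)) *\<^sub>R v"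
      by (intro tendsto_intros LIMSEQ_ignore_initial_segment[OF lims(3)] LIMSEQ_ignore_initial_segment[OF lims(4)]) auto
    then have "(\<lambda>k. tr (z k) (m k)) \<longlonglongrightarrow> v" unfolding m(2) by simp
    moreover have "m k \<in> C" for k using m(1) sub_C[OF zU] by blast
    ultimately obtain m' where m': "m \<longlonglongrightarrow> m'" "tr y m' = v"
      using multiplier_limit[OF y z zU] by blast
    \<comment> \<open>The base points lie on the graph, so convergence in the epigraph supplies
      convergence of the values of \<open>g\<close>; continuity of \<open>\<Phi>\<close> alone would
      not.\<close>
    have "(\<lambda>k. real_of_ereal (g (\<Phi> (z k)))) \<longlonglongrightarrow> real_of_ereal (g (\<Phi> y))"
      using LIMSEQ_ignore_initial_segment[OF lims(2), of N] reg(1) rep[OF zU] rep[OF y] by (simp add: \<gamma>_def)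
    then have "m' \<in> subdifferential g (\<Phi> y)"
      by (rule subdifferential_limit[OF conv m(1) m'(1) tendsto_at(1)[OF y z] _ fin])
    then show "v \<in> tr y ` subdifferential g (\<Phi> y)" using m'(2) by blast
  qed
qed

end

section \<open>The graph of the subdifferential\<close>

context nondegenerate_composite
begin

text \<open>The orthogonal complement of the image of \<open>S\<close> under \<open>tr y\<close>. At
  a point of the set where \<open>\<Phi> y - \<Phi> x\<close> is orthogonal to \<open>S\<close>, it
  is the tangent space of that set.\<close>

definition L where "L y = {w. \<forall>s\<in>S. s \<bullet> A y w = 0}"

text \<open>The limit of the normal spaces to the graph at \<open>(x, tr x m)\<close> as \<open>m\<close> tends to \<open>l\<close> within the
  relative interior of \<open>C\<close>.\<close>

definition limit_normals where
  "limit_normals = {(p, q). q \<in> L x \<and> (\<forall>w\<in>L x. p \<bullet> w + l \<bullet> H x w q = 0)}"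

section \<open>Description of the graph by multipliers\<close>

lemma gph_iff: "y \<in> U \<Longrightarrow> (y, v) \<in> G \<longleftrightarrow> (\<exists>m\<in>subdifferential g (\<Phi> y). v = tr y m)"
  by (auto simp: gph_def chain_rule)

lemma gph_base: "m \<in> C \<Longrightarrow> (x, tr x m) \<in> G"
  using gph_iff[OF U(2)] by blast

lemma convex_C: "convex C"
  by (rule convex_subdifferential[OF conv])

lemma ri_maximizer:
  assumes "y \<in> U" "m \<in> rel_interior C" "m \<in> subdifferential g (\<Phi> y)" "s \<in> S"
  shows "s \<bullet> (\<Phi> y - \<Phi> x) = 0"
  by (rule rel_interior_maximizer[OF assms(2) _ assms(4)]) (use assms(3) faces[OF assms(1)] in auto)

text \<open>A converse to \<open>ri_maximizer\<close>: within \<open>U\<close>, the base points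
  carrying a relative interior multiplier are exactly those with \<open>\<Phi> y - \<Phi> x\<close>
  orthogonal to \<open>S\<close>, and each of them carries all of \<open>C\<close>.\<close>

lemma orthogonal_face:
  assumes "y \<in> U" "\<And>s. s \<in> S \<Longrightarrow> s \<bullet> (\<Phi> y - \<Phi> x) = 0"
  shows "subdifferential g (\<Phi> y) = C"
proof -
  have "m \<bullet> (\<Phi> y - \<Phi> x) \<le> n \<bullet> (\<Phi> y - \<Phi> x)" if "m \<in> C" "n \<in> C" for m n
    using assms(2)[OF diff_S[OF that]] by (simp add: inner_diff_left)
  then show ?thesis using faces[OF assms(1)] by blast
qed

lemma L_decomposition:
  assumes "y \<in> U"
  obtains w0 s where "w0 \<in> L y" "s \<in> S" "w = w0 + tr y s"
proof -
  have sp: "span (tr y ` S) = tr y ` S"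
    unfolding span_eq_iff by (rule linear_subspace_image[OF linear_adjoint_blinfun subspace_direction_space])
  obtain p q where pq: "p \<in> tr y ` S" "\<And>z. z \<in> tr y ` S \<Longrightarrow> orthogonal q z" "w = p + q"
    using orthogonal_subspace_decomp_exists[of "tr y ` S" w] unfolding sp by metis
  obtain s where s: "s \<in> S" "p = tr y s" using pq(1) by blast
  have "r \<bullet> A y q = 0" if "r \<in> S" for r
  proof -
    have "orthogonal q (tr y r)" using pq(2) that by blast
    then show ?thesis by (metis orthogonal_def adjoint_blinfun_inner inner_commute)
  qed
  then show ?thesis using that[of q s] s pq(3) by (simp add: L_def add.commute)
qed

text \<open>The adjoint is injective on \<open>S\<close>, so the derivative can match any
  \<open>d\<close> as far as \<open>S\<close> detects it; this pulls a supporting direction of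
  \<open>C\<close> back to the space of \<open>x\<close>.\<close>

lemma surj_on_S:
  assumes "y \<in> U"
  obtains w where "\<And>s. s \<in> S \<Longrightarrow> s \<bullet> A y w = s \<bullet> d"
proof -
  have lin: "linear (blinfun_apply (A y))"
    by (rule bounded_linear.linear[OF blinfun.bounded_linear_right])
  obtain B where B: "\<And>y' s. s \<in> S \<Longrightarrow> s \<bullet> A y (B y') = s \<bullet> y'"
    using projected_right_inverse[OF lin subspace_direction_space A_inj[OF assms]] by blast
  show ?thesis by (rule that[of "B d"]) (rule B)
qed

section \<open>Tangent vectors of the graph\<close>

lemma gph_tangentE:
  assumes T: "(w, z) \<in> tangent_cone G (x, tr x m)" and m: "m \<in> C"
  obtains t u n where "\<And>k::nat. t k > (0::real)" "t \<longlonglongrightarrow> 0" "u \<longlonglongrightarrow> w" "\<And>k. x + t k *\<^sub>R u k \<in> U"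
    "\<And>k. n k \<in> subdifferential g (\<Phi> (x + t k *\<^sub>R u k))" "n \<longlonglongrightarrow> m"
    "\<And>q. (\<lambda>k. ((n k - m) \<bullet> A x q) / t k) \<longlonglongrightarrow> z \<bullet> q - m \<bullet> H x w q"
proof -
  obtain t' u' where tu: "\<And>k::nat. t' k > (0::real)" "t' \<longlonglongrightarrow> 0" "u' \<longlonglongrightarrow> (w, z)"
      "\<And>k. (x, tr x m) + t' k *\<^sub>R u' k \<in> G"
    using tangent_coneE[OF T] by blast
  have fst_u: "(\<lambda>k. fst (u' k)) \<longlonglongrightarrow> w" and snd_u: "(\<lambda>k. snd (u' k)) \<longlonglongrightarrow> z"
    using tendsto_fst[OF tu(3)] tendsto_snd[OF tu(3)] by auto
  have "\<forall>\<^sub>F k in sequentially. x + t' k *\<^sub>R fst (u' k) \<in> U"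
    by (rule eventually_U[OF U(2) tangent_base_tendsto[OF tu(2) fst_u]])
  then obtain N where N: "\<And>k. k \<ge> N \<Longrightarrow> x + t' k *\<^sub>R fst (u' k) \<in> U"
    by (auto simp: eventually_sequentially)
  define t u v where "t k = t' (k + N)" and "u k = fst (u' (k + N))" and "v k = snd (u' (k + N))" for k
  have t: "\<And>k. t k > 0" "t \<longlonglongrightarrow> 0" and u: "u \<longlonglongrightarrow> w" and v: "v \<longlonglongrightarrow> z"
    using tu(1) LIMSEQ_ignore_initial_segment[OF tu(2), of N] LIMSEQ_ignore_initial_segment[OF fst_u, of N]
      LIMSEQ_ignore_initial_segment[OF snd_u, of N] by (simp_all add: t_def[abs_def] u_def[abs_def] v_def[abs_def])
  define y where "y k = x + t k *\<^sub>R u k" for k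
  have yU: "y k \<in> U" for k using N by (simp add: y_def t_def u_def)
  have y: "y \<longlonglongrightarrow> x" unfolding y_def by (rule tangent_base_tendsto[OF t(2) u])
  have "(y k, tr x m + t k *\<^sub>R v k) \<in> G" for k
    using tu(4)[of "k + N"] by (cases "u' (k + N)") (simp add: y_def t_def u_def v_def)
  then have "\<exists>n. \<forall>k. n k \<in> subdifferential g (\<Phi> (y k)) \<and> tr x m + t k *\<^sub>R v k = tr (y k) (n k)"
    by (intro choice) (use gph_iff[OF yU] in blast)
  then obtain n where n: "\<And>k. n k \<in> subdifferential g (\<Phi> (y k))" "\<And>k. tr x m + t k *\<^sub>R v k = tr (y k) (n k)"
    by blast
  have nC: "n k \<in> C" for k using n(1) sub_C[OF yU] by blast
  have "(\<lambda>k. tr (y k) (n k)) \<longlonglongrightarrow> tr x m"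
    using tangent_base_tendsto[OF t(2) v, of "tr x m"] unfolding n(2) .
  then have lim_n: "n \<longlonglongrightarrow> m"
    by (intro multiplier_tendsto[OF U(2) y _ m]) (use nC in auto)
  \<comment> \<open>Increments of graph points split into a change of the derivative, with limit
    \<open>m \<bullet> H x w q\<close>, and a change of the multiplier seen through
    \<open>A x\<close>; subtracting the former isolates the latter.\<close>
  have quot: "(\<lambda>k. ((n k - m) \<bullet> A x q) / t k) \<longlonglongrightarrow> z \<bullet> q - m \<bullet> H x w q" for q
  proof -
    have "((n k - m) \<bullet> A x q) / t k = v k \<bullet> q - n k \<bullet> ((A (y k) - A x) /\<^sub>R t k) q" for k
    proof -
      have "t k * (v k \<bullet> q) = n k \<bullet> A (y k) q - m \<bullet> A x q"
        using arg_cong[OF n(2), of "\<lambda>z. z \<bullet> q" k] by (simp add: inner_add_left adjoint_blinfun_inner)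
      then have "v k \<bullet> q = (n k \<bullet> A (y k) q - m \<bullet> A x q) / t k"
        using t(1)[of k] by (simp add: field_simps)
      then show ?thesis
        by (simp add: blinfun.bilinear_simps inner_diff_left inner_diff_right divide_inverse algebra_simps)
    qed
    moreover have "(\<lambda>k. v k \<bullet> q - n k \<bullet> ((A (y k) - A x) /\<^sub>R t k) q) \<longlonglongrightarrow> z \<bullet> q - m \<bullet> H x w q"
      unfolding y_def
      by (intro tendsto_intros v lim_n directional_limit[OF H[OF U(2)] t u])
    ultimately show ?thesis by simp
  qed
  show ?thesis
    by (rule that[OF t u _ _ lim_n quot]) (use yU n(1) in \<open>auto simp: y_def\<close>)
qed

lemma gph_tangentI:
  assumes y: "y \<in> U" and t: "\<And>k::nat. t k > (0::real)" "t \<longlonglongrightarrow> 0" and u: "u \<longlonglongrightarrow> w"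
    and m: "\<forall>\<^sub>F k in sequentially. m + t k *\<^sub>R s \<in> subdifferential g (\<Phi> (y + t k *\<^sub>R u k))"
  shows "(w, adjoint (blinfun_apply (H y w)) m + tr y s) \<in> tangent_cone G (y, tr y m)"
proof -
  define z where "z k = y + t k *\<^sub>R u k" for k
  have z: "z \<longlonglongrightarrow> y" unfolding z_def by (rule tangent_base_tendsto[OF t(2) u])
  define r where "r k = (tr (z k) (m + t k *\<^sub>R s) - tr y m) /\<^sub>R t k" for k
  have r: "r k = adjoint (blinfun_apply ((A (z k) - A y) /\<^sub>R t k)) m + tr (z k) s" for k
    unfolding r_def by (rule adjoint_blinfun_diff_quotient[OF t(1)])
  have "(\<lambda>k. (A (z k) - A y) /\<^sub>R t k) \<longlonglongrightarrow> H y w"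
    unfolding z_def by (rule directional_limit[OF H[OF y] t u])
  then have "r \<longlonglongrightarrow> adjoint (blinfun_apply (H y w)) m + tr y s"
    unfolding r by (intro tendsto_add tendsto_adjoint_blinfun tendsto_const tendsto_at(2)[OF y z])
  then have lim: "(\<lambda>k. (u k, r k)) \<longlonglongrightarrow> (w, adjoint (blinfun_apply (H y w)) m + tr y s)"
    by (rule tendsto_Pair[OF u])
  show ?thesis
  proof (rule tangent_coneI[OF t lim])
    show "\<forall>\<^sub>F k in sequentially. (y, tr y m) + t k *\<^sub>R (u k, r k) \<in> G"
      using eventually_U[OF y z] m
    proof eventually_elim
      case (elim k)
      have "tr y m + t k *\<^sub>R r k = tr (z k) (m + t k *\<^sub>R s)"
        using t(1)[of k] by (simp add: r_def)
      then show ?case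
        using gph_iff[OF elim(1)] elim(2) by (auto simp: z_def)
    qed
  qed
qed

text \<open>Nearby multipliers remain in the relative interior, so \<open>\<Phi>\<close> moves
  orthogonally to \<open>S\<close>, which puts \<open>w\<close> in \<open>L x\<close>. Multiplier
  increments lie in \<open>S\<close> and vanish against \<open>L x\<close>, so on \<open>L x\<close>
  only the second-order term remains.\<close>

lemma gph_tangent_upper:
  assumes m: "m \<in> rel_interior C" and T: "(w, z) \<in> tangent_cone G (x, tr x m)"
  shows "w \<in> L x" and "q \<in> L x \<Longrightarrow> z \<bullet> q = m \<bullet> H x w q"
proof -
  have mC: "m \<in> C" using m rel_interior_subset by blast
  obtain t u n where t: "\<And>k::nat. t k > (0::real)" "t \<longlonglongrightarrow> 0" and u: "u \<longlonglongrightarrow> w"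
    and yU: "\<And>k. x + t k *\<^sub>R u k \<in> U"
    and n: "\<And>k. n k \<in> subdifferential g (\<Phi> (x + t k *\<^sub>R u k))" "n \<longlonglongrightarrow> m"
    and quot: "\<And>q. (\<lambda>k. ((n k - m) \<bullet> A x q) / t k) \<longlonglongrightarrow> z \<bullet> q - m \<bullet> H x w q"
    by (rule gph_tangentE[OF T mC]) (rule that)
  have nC: "n k \<in> C" for k using n(1) sub_C[OF yU] by blast
  have ri: "\<forall>\<^sub>F k in sequentially. n k \<in> rel_interior C"
    by (rule rel_interior_eventually[OF m n(2)]) (use nC in auto)
  have "s \<bullet> A x w = 0" if s: "s \<in> S" for s
  proof -
    from ri have "\<forall>\<^sub>F k in sequentially. s \<bullet> ((\<Phi> (x + t k *\<^sub>R u k) - \<Phi> x) /\<^sub>R t k) = 0"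
      by eventually_elim (use ri_maximizer[OF yU _ n(1) s] in simp)
    from tendsto_eventually[OF this] show ?thesis
      by (rule LIMSEQ_unique[rotated]) (intro tendsto_intros directional_limit[OF A[OF U(2)] t u])
  qed
  then show "w \<in> L x" by (simp add: L_def)
  show "z \<bullet> q = m \<bullet> H x w q" if "q \<in> L x"
  proof -
    have "(n k - m) \<bullet> A x q = 0" for k
      using that diff_S[OF nC mC] by (simp add: L_def)
    then show ?thesis using quot[of q] by (simp add: LIMSEQ_const_iff)
  qed
qed

text \<open>Stated at every \<open>y\<close> of the orthogonality set and not just at
  \<open>x\<close>, because limiting normals at \<open>(x, tr x l)\<close> are limits of regular
  normals at such nearby points.\<close>

lemma gph_tangent_lower:
  assumes y: "y \<in> U" and face: "\<And>s. s \<in> S \<Longrightarrow> s \<bullet> (\<Phi> y - \<Phi> x) = 0"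
    and m: "m \<in> rel_interior C" and w: "w \<in> L y" and s: "s \<in> S"
  shows "(w, adjoint (blinfun_apply (H y w)) m + tr y s) \<in> tangent_cone G (y, tr y m)"
proof -
  obtain t u where tu: "\<And>k::nat. t k > (0::real)" "t \<longlonglongrightarrow> 0" "u \<longlonglongrightarrow> w"
    "\<And>k s. s \<in> S \<Longrightarrow> s \<bullet> (\<Phi> (y + t k *\<^sub>R u k) - \<Phi> y - t k *\<^sub>R A y w) = 0"
    using path[OF y] by blast
  obtain e where e: "e > 0" "\<And>s. s \<in> S \<Longrightarrow> norm s < e \<Longrightarrow> m + s \<in> C"
    using rel_interior_translate[OF m] by blast
  have "(\<lambda>k. norm (t k *\<^sub>R s)) \<longlonglongrightarrow> norm (0 *\<^sub>R s)"
    by (intro tendsto_intros tu)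
  then have "\<forall>\<^sub>F k in sequentially. norm (t k *\<^sub>R s) < e"
    using e(1) by (intro order_tendstoD(2)) auto
  with eventually_U[OF y tangent_base_tendsto[OF tu(2,3)]]
  have "\<forall>\<^sub>F k in sequentially. m + t k *\<^sub>R s \<in> subdifferential g (\<Phi> (y + t k *\<^sub>R u k))"
  proof eventually_elim
    case (elim k)
    have "subdifferential g (\<Phi> (y + t k *\<^sub>R u k)) = C"
    proof (rule orthogonal_face[OF elim(1)])
      fix r assume r: "r \<in> S"
      then have "r \<bullet> A y w = 0" using w by (simp add: L_def)
      then show "r \<bullet> (\<Phi> (y + t k *\<^sub>R u k) - \<Phi> x) = 0"
        using tu(4)[OF r, of k] face[OF r] by (simp add: inner_diff_right)
    qed
    then show ?case
      using e(2)[OF subspace_scale[OF subspace_direction_space s] elim(2)] by simp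
  qed
  then show ?thesis by (rule gph_tangentI[OF y tu(1,2,3)])
qed

section \<open>Normal vectors of the graph\<close>

lemma limit_normals_regular:
  assumes m: "m \<in> rel_interior C" and q: "q \<in> L x" and p: "\<And>w. w \<in> L x \<Longrightarrow> p \<bullet> w + m \<bullet> H x w q = 0"
  shows "(p, q) \<in> regular_normal_cone G (x, tr x m)"
proof (rule regular_normalI)
  fix wz assume "wz \<in> tangent_cone G (x, tr x m)"
  moreover obtain w z where wz: "wz = (w, z)" by (cases wz)
  ultimately have "w \<in> L x" "z \<bullet> q = m \<bullet> H x w q"
    using gph_tangent_upper[OF m] q by blast+
  then show "(p, q) \<bullet> wz \<le> 0" using p[of w] by (simp add: wz inner_commute)
qed

lemma limit_normals_subset: "limit_normals \<subseteq> limiting_normal_cone G (x, tr x l)"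
proof
  fix pq assume "pq \<in> limit_normals"
  then obtain p q where pq: "pq = (p, q)" and q: "q \<in> L x" and p: "\<And>w. w \<in> L x \<Longrightarrow> p \<bullet> w + l \<bullet> H x w q = 0"
    by (auto simp: limit_normals_def)
  obtain m where m: "\<And>k::nat. m k \<in> rel_interior C" "m \<longlonglongrightarrow> l"
    using rel_interior_sequence[OF convex_C l] by blast
  \<comment> \<open>\<open>h k\<close> represents the functional by which the second-order terms at
    \<open>l\<close> and at \<open>m k\<close> differ; adding it to \<open>p\<close> makes the
    relation exact at \<open>m k\<close>, and it tends to 0.\<close>
  define h where "h k = adjoint (\<lambda>w. H x w q) (l - m k)" for k
  have lin: "linear (\<lambda>w. H x w q)"
    by (rule linearI) (simp_all add: blinfun.bilinear_simps)
  have h: "h k \<bullet> w = (l - m k) \<bullet> H x w q" for k w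
    unfolding h_def by (rule adjoint_clauses(2)[OF lin])
  have "h k = (\<Sum>b\<in>Basis. ((l - m k) \<bullet> H x b q) *\<^sub>R b)" for k
    unfolding h[symmetric] by (rule euclidean_representation[symmetric])
  then have h_sum: "h = (\<lambda>k. \<Sum>b\<in>Basis. ((l - m k) \<bullet> H x b q) *\<^sub>R b)" by blast
  have "h \<longlonglongrightarrow> (\<Sum>b\<in>Basis. ((l - l) \<bullet> H x b q) *\<^sub>R b)"
    unfolding h_sum by (intro tendsto_intros m)
  then have h0: "h \<longlonglongrightarrow> 0" by simp
  have "(p + 0, q) \<in> limiting_normal_cone G (x, tr x l)"
  proof (rule limiting_normalI[of "\<lambda>k. (x, tr x (m k))" _ "\<lambda>k. (p + h k, q)"])
    show "\<forall>\<^sub>F k in sequentially. (x, tr x (m k)) \<in> G \<and> (p + h k, q) \<in> regular_normal_cone G (x, tr x (m k))"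
    proof (intro always_eventually allI conjI)
      fix k
      show "(x, tr x (m k)) \<in> G" using m(1) rel_interior_subset by (intro gph_base) blast
      show "(p + h k, q) \<in> regular_normal_cone G (x, tr x (m k))"
      proof (rule limit_normals_regular[OF m(1) q])
        fix w assume "w \<in> L x"
        from p[OF this] show "(p + h k) \<bullet> w + m k \<bullet> H x w q = 0"
          by (simp add: inner_add_left h inner_diff_left)
      qed
    qed
    show "(\<lambda>k. (x, tr x (m k))) \<longlonglongrightarrow> (x, tr x l)"
      by (intro tendsto_intros tendsto_adjoint_blinfun m)
    show "(\<lambda>k. (p + h k, q)) \<longlonglongrightarrow> (p + 0, q)"
      by (intro tendsto_intros h0)
  qed
  then show "pq \<in> limiting_normal_cone G (x, tr x l)" by (simp add: pq)
qed

text \<open>Subtract from \<open>w\<close> its component in the image of \<open>S\<close> under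
  \<open>tr (y k)\<close>. Since \<open>s \<bullet> A x w = 0\<close> for \<open>s\<close> in
  \<open>S\<close>, that component is controlled by \<open>(A (y k) - A x) w\<close> divided by
  \<open>c\<close>.\<close>

lemma L_approximation:
  assumes w: "w \<in> L x" and y: "y \<longlonglongrightarrow> x" "\<And>k::nat. y k \<in> U"
  obtains w' where "\<And>k. w' k \<in> L (y k)" "w' \<longlonglongrightarrow> w"
proof -
  have "\<exists>s. \<forall>k. s k \<in> S \<and> w - tr (y k) (s k) \<in> L (y k)"
  proof (intro choice allI)
    fix k
    obtain w0 s where "w0 \<in> L (y k)" "s \<in> S" "w = w0 + tr (y k) s"
      using L_decomposition[OF y(2)] by blast
    then show "\<exists>s. s \<in> S \<and> w - tr (y k) s \<in> L (y k)" by (intro exI[of _ s]) simp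
  qed
  then obtain s where s: "\<And>k. s k \<in> S" "\<And>k. w - tr (y k) (s k) \<in> L (y k)" by blast
  have bound: "norm (tr (y k) (s k)) \<le> (1 / c) * norm ((A (y k) - A x) w)" for k
  proof -
    let ?z = "tr (y k) (s k)"
    have "s k \<bullet> A (y k) (w - ?z) = 0" using s by (simp add: L_def)
    then have "?z \<bullet> (w - ?z) = 0" by (simp only: adjoint_blinfun_inner)
    then have "norm ?z * norm ?z = ?z \<bullet> w"
      by (simp add: inner_diff_right) (metis power2_norm_eq_inner power2_eq_square)
    also have "\<dots> = s k \<bullet> (A (y k) - A x) w"
      using w s(1)[of k] by (simp add: adjoint_blinfun_inner L_def blinfun.diff_left inner_diff_right)
    also have "\<dots> \<le> norm (s k) * norm ((A (y k) - A x) w)" by (rule norm_cauchy_schwarz)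
    also have "\<dots> \<le> (norm ?z / c) * norm ((A (y k) - A x) w)"
      using c(2)[OF y(2) s(1), of k k] c(1)
      by (intro mult_right_mono) (simp_all add: pos_le_divide_eq mult.commute)
    finally have *: "norm ?z * norm ?z \<le> norm ?z * ((1 / c) * norm ((A (y k) - A x) w))" by simp
    show ?thesis
    proof (cases "norm ?z = 0")
      case False
      then show ?thesis by (intro mult_left_le_imp_le[OF *]) simp
    qed (use c(1) in simp)
  qed
  have "(\<lambda>k. (1 / c) * norm ((A (y k) - A x) w)) \<longlonglongrightarrow> (1 / c) * norm ((A x - A x) w)"
    by (intro tendsto_intros tendsto_at(2)[OF U(2) y(1)])
  then have 0: "(\<lambda>k. (1 / c) * norm ((A (y k) - A x) w)) \<longlonglongrightarrow> 0" by simp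
  have "(\<lambda>k. tr (y k) (s k)) \<longlonglongrightarrow> 0"
    by (rule tendsto_norm_zero_cancel, rule tendsto_sandwich[OF _ _ tendsto_const 0])
      (use bound in \<open>auto intro!: always_eventually\<close>)
  from tendsto_diff[OF tendsto_const this, of w] show ?thesis
    by (intro that[of "\<lambda>k. w - tr (y k) (s k)"]) (use s(2) in auto)
qed

text \<open>Regular normals at nearby graph points annihilate the linear spaces of
  \<open>gph_tangent_lower\<close>; these equations pass to the limit because \<open>H\<close> is
  continuous and every vector of \<open>L x\<close> is a limit of vectors of
  \<open>L (y k)\<close>.\<close>

lemma limiting_subset:
  assumes l_ri: "l \<in> rel_interior C"
  shows "limiting_normal_cone G (x, tr x l) \<subseteq> limit_normals"
proof
  fix pq assume "pq \<in> limiting_normal_cone G (x, tr x l)"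
  then obtain e n where e: "\<And>k::nat. e k \<in> G" "e \<longlonglongrightarrow> (x, tr x l)"
    and n: "\<And>k. n k \<in> regular_normal_cone G (e k)" "n \<longlonglongrightarrow> pq"
    by (rule limiting_normalE) blast
  have fe: "(\<lambda>k. fst (e k)) \<longlonglongrightarrow> x" and se: "(\<lambda>k. snd (e k)) \<longlonglongrightarrow> tr x l"
    using tendsto_fst[OF e(2)] tendsto_snd[OF e(2)] by auto
  have ev: "\<forall>\<^sub>F k in sequentially. \<exists>m. fst (e k) \<in> U \<and> m \<in> subdifferential g (\<Phi> (fst (e k))) \<and> snd (e k) = tr (fst (e k)) m"
    using eventually_U[OF U(2) fe]
  proof eventually_elim
    case (elim k)
    then show ?case using e(1)[of k] gph_iff[OF elim, of "snd (e k)"] by auto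
  qed
  \<comment> \<open>Multipliers exist only from some index on, hence the choice by
    \<open>SOME\<close>; earlier values are arbitrary.\<close>
  define m where "m k = (SOME m. fst (e k) \<in> U \<and> m \<in> subdifferential g (\<Phi> (fst (e k))) \<and> snd (e k) = tr (fst (e k)) m)" for k
  have m: "\<forall>\<^sub>F k in sequentially. fst (e k) \<in> U \<and> m k \<in> subdifferential g (\<Phi> (fst (e k))) \<and> snd (e k) = tr (fst (e k)) (m k)"
    using ev by eventually_elim (unfold m_def, rule someI_ex)
  have mC: "\<forall>\<^sub>F k in sequentially. m k \<in> C"
    using m by eventually_elim (use sub_C in blast)
  have "(\<lambda>k. tr (fst (e k)) (m k)) \<longlonglongrightarrow> tr x l"
    by (rule Lim_transform_eventually[OF se]) (use m in eventually_elim, simp)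
  then have ml: "m \<longlonglongrightarrow> l" by (rule multiplier_tendsto[OF U(2) fe mC l])
  have "\<forall>\<^sub>F k in sequentially. fst (e k) \<in> U \<and> m k \<in> subdifferential g (\<Phi> (fst (e k)))
      \<and> snd (e k) = tr (fst (e k)) (m k) \<and> m k \<in> rel_interior C"
    using m rel_interior_eventually[OF l_ri ml mC] by eventually_elim blast
  then obtain N where N: "\<And>k. k \<ge> N \<Longrightarrow> fst (e k) \<in> U \<and> m k \<in> subdifferential g (\<Phi> (fst (e k)))
      \<and> snd (e k) = tr (fst (e k)) (m k) \<and> m k \<in> rel_interior C"
    by (auto simp: eventually_sequentially)
  define y m' p q where "y k = fst (e (k + N))" and "m' k = m (k + N)"
    and "p k = fst (n (k + N))" and "q k = snd (n (k + N))" for k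
  have yU: "\<And>k. y k \<in> U" and m's: "\<And>k. m' k \<in> subdifferential g (\<Phi> (y k))"
    and ey: "\<And>k. e (k + N) = (y k, tr (y k) (m' k))" and ri: "\<And>k. m' k \<in> rel_interior C"
    using N by (auto simp: y_def m'_def prod_eq_iff)
  have y: "y \<longlonglongrightarrow> x" and m': "m' \<longlonglongrightarrow> l" and p: "p \<longlonglongrightarrow> fst pq" and q: "q \<longlonglongrightarrow> snd pq"
    unfolding y_def m'_def p_def q_def
    using LIMSEQ_ignore_initial_segment[OF fe, of N] LIMSEQ_ignore_initial_segment[OF ml, of N]
      LIMSEQ_ignore_initial_segment[OF tendsto_fst[OF n(2)], of N]
      LIMSEQ_ignore_initial_segment[OF tendsto_snd[OF n(2)], of N] by auto
  have reg: "(p k, q k) \<in> regular_normal_cone G (y k, tr (y k) (m' k))" for k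
    using n(1)[of "k + N"] unfolding ey by (simp add: p_def q_def)
  have le: "p k \<bullet> w + m' k \<bullet> H (y k) w (q k) + s \<bullet> A (y k) (q k) \<le> 0" if "w \<in> L (y k)" "s \<in> S" for k w s
  proof -
    have "(w, adjoint (blinfun_apply (H (y k) w)) (m' k) + tr (y k) s) \<in> tangent_cone G (y k, tr (y k) (m' k))"
      by (rule gph_tangent_lower[OF yU ri_maximizer[OF yU ri m's] ri that])
    from regular_normalD[OF reg this] show ?thesis
      by (simp add: inner_add_right inner_commute[of "q k"] adjoint_blinfun_inner)
  qed
  \<comment> \<open>Both spaces are closed under negation, so \<open>le\<close> tested in opposite
    directions becomes one equation in \<open>s\<close> and another in \<open>w\<close>.\<close>
  have L0: "0 \<in> L (y k)" "w \<in> L (y k) \<Longrightarrow> - w \<in> L (y k)" for k w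
    by (auto simp: L_def blinfun.bilinear_simps)
  have S0: "0 \<in> S" "s \<in> S \<Longrightarrow> - s \<in> S" for s
    by (auto intro: subspace_0 subspace_neg subspace_direction_space)
  have s_eq: "s \<bullet> A (y k) (q k) = 0" if "s \<in> S" for s k
    using le[OF L0(1)[of k] that] le[OF L0(1)[of k] S0(2)[OF that]] by (simp add: blinfun.bilinear_simps)
  have w_eq: "p k \<bullet> w + m' k \<bullet> H (y k) w (q k) = 0" if "w \<in> L (y k)" for w k
    using le[OF that S0(1)] le[OF L0(2)[OF that] S0(1)] by (simp add: blinfun.bilinear_simps)
  have "snd pq \<in> L x"
    unfolding L_def
  proof (intro CollectI ballI)
    fix s assume s: "s \<in> S"
    have "(\<lambda>k. s \<bullet> A (y k) (q k)) \<longlonglongrightarrow> s \<bullet> A x (snd pq)"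
      by (intro tendsto_intros tendsto_at(2)[OF U(2) y] q)
    then show "s \<bullet> A x (snd pq) = 0" by (simp add: s_eq[OF s] LIMSEQ_const_iff)
  qed
  moreover have "fst pq \<bullet> w + l \<bullet> H x w (snd pq) = 0" if w: "w \<in> L x" for w
  proof -
    obtain w' where w': "\<And>k. w' k \<in> L (y k)" "w' \<longlonglongrightarrow> w"
      using L_approximation[OF w y yU] by blast
    have "(\<lambda>k. p k \<bullet> w' k + m' k \<bullet> H (y k) (w' k) (q k)) \<longlonglongrightarrow> fst pq \<bullet> w + l \<bullet> H x w (snd pq)"
      by (intro tendsto_intros tendsto_at(3)[OF U(2) y] p q w' m')
    then show ?thesis by (simp add: w_eq[OF w'(1)] LIMSEQ_const_iff)
  qed
  ultimately show "pq \<in> limit_normals" by (cases pq) (simp add: limit_normals_def)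
qed

lemma ri_imp_regular:
  assumes "l \<in> rel_interior C"
  shows "regular_normal_cone G (x, tr x l) = limiting_normal_cone G (x, tr x l)"
proof
  show "regular_normal_cone G (x, tr x l) \<subseteq> limiting_normal_cone G (x, tr x l)"
    by (rule regular_subset_limiting[OF gph_base[OF l]])
  have "limit_normals \<subseteq> regular_normal_cone G (x, tr x l)"
    using limit_normals_regular[OF assms] by (auto simp: limit_normals_def)
  then show "limiting_normal_cone G (x, tr x l) \<subseteq> regular_normal_cone G (x, tr x l)"
    using limiting_subset[OF assms] by blast
qed

lemma H_symmetric: "m \<bullet> H x u w = m \<bullet> H x w u"
proof -
  interpret K: bounded_linear "\<lambda>T :: 'a \<Rightarrow>\<^sub>L 'b. blinfun_compose (blinfun_inner_left m) T"
    by (rule bounded_bilinear.bounded_linear_right[OF bounded_bilinear_blinfun_compose])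
  have "blinfun_compose (blinfun_inner_left m) (H x u) w = blinfun_compose (blinfun_inner_left m) (H x w) u"
  proof (rule second_derivative_symmetric[OF U])
    show "((\<lambda>y. \<Phi> y \<bullet> m) has_derivative blinfun_apply (blinfun_compose (blinfun_inner_left m) (A y))) (at y)"
      if "y \<in> U" for y
      using A[OF that] by (auto intro!: derivative_eq_intros)
    show "((\<lambda>y. blinfun_compose (blinfun_inner_left m) (A y)) has_derivative
        (\<lambda>h. blinfun_compose (blinfun_inner_left m) (H x h))) (at x)"
      by (rule K.has_derivative[OF H[OF U(2)]])
  qed
  then show ?thesis by (simp add: inner_commute)
qed

text \<open>Both memberships amount to \<open>w \<in> L x\<close> together with
  \<open>z \<bullet> q = l \<bullet> H x w q\<close> for all \<open>q \<in> L x\<close>; on the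
  normal side the arguments \<open>w\<close> and \<open>q\<close> appear interchanged, and symmetry
  identifies the two.\<close>

lemma ri_imp_derivative_eq_coderivative:
  assumes ri: "l \<in> rel_interior C"
  shows "graphical_derivative (subdifferential \<phi>) x (tr x l) w = coderivative (subdifferential \<phi>) x (tr x l) w"
proof -
  have N: "limiting_normal_cone G (x, tr x l) = limit_normals"
    using limiting_subset[OF ri] limit_normals_subset by blast
  have Lm: "- w \<in> L x \<longleftrightarrow> w \<in> L x" for w by (simp add: L_def blinfun.bilinear_simps)
  have "(w, z) \<in> tangent_cone G (x, tr x l) \<longleftrightarrow> (z, - w) \<in> limit_normals" for z
  proof
    assume T: "(w, z) \<in> tangent_cone G (x, tr x l)"
    show "(z, - w) \<in> limit_normals"
      using gph_tangent_upper[OF ri T] by (simp add: limit_normals_def Lm blinfun.bilinear_simps H_symmetric[of _ _ w])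
  next
    assume "(z, - w) \<in> limit_normals"
    then have w: "w \<in> L x" and z: "\<And>q. q \<in> L x \<Longrightarrow> z \<bullet> q = l \<bullet> H x w q"
      by (auto simp: limit_normals_def Lm blinfun.bilinear_simps H_symmetric[of _ _ w])
    obtain w0 s where s: "w0 \<in> L x" "s \<in> S" "z - adjoint (blinfun_apply (H x w)) l = w0 + tr x s"
      using L_decomposition[OF U(2)] by blast
    \<comment> \<open>The part of \<open>z\<close> in \<open>L x\<close> not accounted for by the
      second-order term is orthogonal to itself, so what is left of \<open>z\<close> comes from
      \<open>S\<close>.\<close>
    have "w0 \<bullet> w0 = (z - adjoint (blinfun_apply (H x w)) l - tr x s) \<bullet> w0" using s(3) by simp
    also have "\<dots> = 0" using z[OF s(1)] s(1,2) by (simp add: inner_diff_left adjoint_blinfun_inner L_def)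
    finally have "z = adjoint (blinfun_apply (H x w)) l + tr x s" using s(3) by (simp add: algebra_simps)
    then show "(w, z) \<in> tangent_cone G (x, tr x l)"
      using gph_tangent_lower[OF U(2) _ ri w s(2)] by simp
  qed
  then show ?thesis by (simp add: graphical_derivative_def coderivative_def N)
qed

section \<open>Multipliers on the relative boundary\<close>

lemma not_ri_supporting:
  assumes "l \<notin> rel_interior C"
  obtains d s where "\<And>m. m \<in> C \<Longrightarrow> m \<bullet> d \<le> l \<bullet> d" "s \<in> S" "s \<bullet> d > 0"
proof -
  obtain a where a: "\<And>m. m \<in> C \<Longrightarrow> a \<bullet> l \<le> a \<bullet> m" "\<And>m. m \<in> rel_interior C \<Longrightarrow> a \<bullet> l < a \<bullet> m"
    using supporting_hyperplane_rel_boundary[OF convex_C l assms] by metis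
  obtain m where m: "m \<in> rel_interior C"
    using rel_interior_eq_empty[OF convex_C] l by blast
  then have "m \<in> C" using rel_interior_subset by blast
  \<comment> \<open>The hyperplane inequality is strict at the relative interior point
    \<open>m\<close>, so \<open>l - m\<close> pairs positively with the reversed normal.\<close>
  show ?thesis
  proof (rule that[of "- a" "l - m"])
    show "m \<bullet> - a \<le> l \<bullet> - a" if "m \<in> C" for m
      using a(1)[of m] that by (auto simp: inner_commute)
    show "l - m \<in> S" by (rule diff_S[OF l \<open>m \<in> C\<close>])
    show "(l - m) \<bullet> - a > 0" using a(2)[OF m] by (simp add: inner_diff_left inner_diff_right inner_commute)
  qed
qed

lemma S_normal: "s \<in> S \<Longrightarrow> (tr x s, 0) \<in> limiting_normal_cone G (x, tr x l)"
  using limit_normals_subset by (force simp: limit_normals_def L_def adjoint_blinfun_inner blinfun.bilinear_simps)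

text \<open>Along a path whose image moves, in its \<open>S\<close>-components, exactly like
  \<open>d\<close>, the multiplier \<open>l\<close> stays maximal, so keeping it constant produces a
  tangent vector. Its pairing with the limiting normal from \<open>S_normal\<close> is
  \<open>s \<bullet> d > 0\<close>, impossible for a regular normal.\<close>

lemma regular_imp_ri:
  assumes eq: "regular_normal_cone G (x, tr x l) = limiting_normal_cone G (x, tr x l)"
  shows "l \<in> rel_interior C"
proof (rule ccontr)
  assume "l \<notin> rel_interior C"
  then obtain d s where d: "\<And>m. m \<in> C \<Longrightarrow> m \<bullet> d \<le> l \<bullet> d" and s: "s \<in> S" "s \<bullet> d > 0"
    using not_ri_supporting by blast
  obtain w where w: "\<And>s. s \<in> S \<Longrightarrow> s \<bullet> A x w = s \<bullet> d"
    using surj_on_S[OF U(2)] by blast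
  obtain t u where tu: "\<And>k::nat. t k > (0::real)" "t \<longlonglongrightarrow> 0" "u \<longlonglongrightarrow> w"
    "\<And>k s. s \<in> S \<Longrightarrow> s \<bullet> (\<Phi> (x + t k *\<^sub>R u k) - \<Phi> x - t k *\<^sub>R A x w) = 0"
    using path[OF U(2)] by blast
  have "\<forall>\<^sub>F k in sequentially. l + t k *\<^sub>R 0 \<in> subdifferential g (\<Phi> (x + t k *\<^sub>R u k))"
    using eventually_U[OF U(2) tangent_base_tendsto[OF tu(2,3)]]
  proof eventually_elim
    case (elim k)
    have "m \<bullet> (\<Phi> (x + t k *\<^sub>R u k) - \<Phi> x) \<le> l \<bullet> (\<Phi> (x + t k *\<^sub>R u k) - \<Phi> x)" if m: "m \<in> C" for m
    proof -
      have "(l - m) \<bullet> (\<Phi> (x + t k *\<^sub>R u k) - \<Phi> x) = t k * ((l - m) \<bullet> d)"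
        using tu(4)[OF diff_S[OF l m], of k] w[OF diff_S[OF l m]] by (simp add: inner_diff_right)
      also have "\<dots> \<ge> 0" using d[OF m] tu(1)[of k] by (simp add: inner_diff_left)
      finally show ?thesis by (simp add: inner_diff_left)
    qed
    then show ?case using faces[OF elim] l by simp
  qed
  from gph_tangentI[OF U(2) tu(1,2,3) this] have
    "(w, adjoint (blinfun_apply (H x w)) l + tr x 0) \<in> tangent_cone G (x, tr x l)" .
  from regular_normalD[OF _ this, of "(tr x s, 0)"] S_normal[OF s(1)]
  have "s \<bullet> A x w \<le> 0" by (simp add: eq adjoint_blinfun_inner)
  then show False using w[OF s(1)] s(2) by simp
qed

text \<open>The contradiction sits at 0: \<open>S_normal\<close> puts \<open>tr x s\<close> into the
  coderivative there, while along a tangent sequence the multipliers stay below \<open>l\<close> in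
  the direction \<open>d\<close>, which would bound \<open>s \<bullet> d\<close> by 0.\<close>

lemma derivative_eq_coderivative_imp_ri:
  assumes eq: "graphical_derivative (subdifferential \<phi>) x (tr x l) 0 = coderivative (subdifferential \<phi>) x (tr x l) 0"
  shows "l \<in> rel_interior C"
proof (rule ccontr)
  assume "l \<notin> rel_interior C"
  then obtain d s where d: "\<And>m. m \<in> C \<Longrightarrow> m \<bullet> d \<le> l \<bullet> d" and s: "s \<in> S" "s \<bullet> d > 0"
    using not_ri_supporting by blast
  obtain w where w: "\<And>s. s \<in> S \<Longrightarrow> s \<bullet> A x w = s \<bullet> d"
    using surj_on_S[OF U(2)] by blast
  have "tr x s \<in> coderivative (subdifferential \<phi>) x (tr x l) 0"
    using S_normal[OF s(1)] by (simp add: coderivative_def)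
  then have T: "(0, tr x s) \<in> tangent_cone G (x, tr x l)"
    using eq by (auto simp: graphical_derivative_def)
  obtain t u n where t: "\<And>k::nat. t k > (0::real)" "t \<longlonglongrightarrow> 0" and u: "u \<longlonglongrightarrow> 0"
    and yU: "\<And>k. x + t k *\<^sub>R u k \<in> U"
    and n: "\<And>k. n k \<in> subdifferential g (\<Phi> (x + t k *\<^sub>R u k))" "n \<longlonglongrightarrow> l"
    and quot: "\<And>q. (\<lambda>k. ((n k - l) \<bullet> A x q) / t k) \<longlonglongrightarrow> tr x s \<bullet> q - l \<bullet> H x 0 q"
    by (rule gph_tangentE[OF T l]) (rule that)
  have "((n k - l) \<bullet> A x w) / t k \<le> 0" for k
  proof -
    have nC: "n k \<in> C" using n(1) sub_C[OF yU] by blast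
    have "(n k - l) \<bullet> A x w = (n k - l) \<bullet> d" by (rule w[OF diff_S[OF nC l]])
    also have "\<dots> \<le> 0" using d[OF nC] by (simp add: inner_diff_left)
    finally show ?thesis using t(1)[of k] by (simp add: divide_nonpos_pos)
  qed
  then have "tr x s \<bullet> w - l \<bullet> H x 0 w \<le> 0"
    by (intro LIMSEQ_le_const2[OF quot]) auto
  then show False using w[OF s(1)] s(2) by (simp add: adjoint_blinfun_inner blinfun.bilinear_simps)
qed

text \<open>Relative interiors of convex sets commute with linear images, and injectivity of
  \<open>tr x\<close> on \<open>S\<close> recovers the multiplier.\<close>

lemma ri_subdifferential_iff: "tr x l \<in> rel_interior (subdifferential \<phi> x) \<longleftrightarrow> l \<in> rel_interior C"
proof -
  have eq: "rel_interior (subdifferential \<phi> x) = tr x ` rel_interior C"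
    unfolding chain_rule[OF U(2)]
    by (rule rel_interior_convex_linear_image[OF linear_adjoint_blinfun convex_C, symmetric])
  have "m = l" if "m \<in> rel_interior C" "tr x l = tr x m" for m
  proof -
    have "m - l \<in> S" using that(1) rel_interior_subset l by (intro diff_S) blast+
    then show ?thesis using tr_inj[OF U(2), of "m - l"] that(2) by (simp add: tr_diff)
  qed
  then show ?thesis unfolding eq by blast
qed

end

section \<open>The equivalence\<close>

text \<open>Injectivity at \<open>x\<close> on a finite-dimensional subspace gives a positive lower
  bound for the adjoint; half of it survives for all derivatives within \<open>c / 2\<close> of the
  one at \<open>x\<close>.\<close>

lemma nondegenerate_composite_exists:
  fixes \<phi> :: "'a::euclidean_space \<Rightarrow> ereal" and g :: "'b::euclidean_space \<Rightarrow> ereal"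
    and \<Phi> :: "'a \<Rightarrow> 'b"
  assumes C2: "C2_around \<Phi> x" and g: "polyhedral_fun g"
    and rep: "open V" "x \<in> V" "\<And>y. y \<in> V \<Longrightarrow> \<phi> y = g (\<Phi> y)"
    and l: "l \<in> subdifferential g (\<Phi> x)"
    and nondeg: "\<And>s. s \<in> direction_space (subdifferential g (\<Phi> x)) \<Longrightarrow>
      adjoint (frechet_derivative \<Phi> (at x)) s = 0 \<Longrightarrow> s = 0"
  obtains A H U c where "nondegenerate_composite \<phi> g \<Phi> A H U x l c"
    "blinfun_apply (A x) = frechet_derivative \<Phi> (at x)"
proof -
  define S where "S = direction_space (subdifferential g (\<Phi> x))"
  obtain U0 and A :: "'a \<Rightarrow> 'a \<Rightarrow>\<^sub>L 'b" and H :: "'a \<Rightarrow> 'a \<Rightarrow>\<^sub>L 'a \<Rightarrow>\<^sub>L 'b"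
    where U0: "open U0" "x \<in> U0"
      and A: "\<And>y. y \<in> U0 \<Longrightarrow> (\<Phi> has_derivative blinfun_apply (A y)) (at y)"
      and H: "\<And>y. y \<in> U0 \<Longrightarrow> (A has_derivative blinfun_apply (H y)) (at y)"
      and H_cont: "continuous_on U0 H"
    using C2 unfolding C2_around_def by blast
  have Ax: "blinfun_apply (A x) = frechet_derivative \<Phi> (at x)"
    by (rule frechet_derivative_at[OF A[OF U0(2)]])
  have fin: "\<bar>g (\<Phi> x)\<bar> \<noteq> \<infinity>" using l by (simp add: subdifferential_def)
  obtain \<epsilon> where \<epsilon>: "\<epsilon> > 0" and near: "\<And>z. norm (z - \<Phi> x) < \<epsilon> \<Longrightarrow> subdifferential g z =
       {l \<in> subdifferential g (\<Phi> x). \<forall>m\<in>subdifferential g (\<Phi> x). m \<bullet> (z - \<Phi> x) \<le> l \<bullet> (z - \<Phi> x)}"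
    using polyhedral_subdifferential_nearby[OF g fin] by blast
  have "\<exists>c>0. \<forall>s\<in>S. c * norm s \<le> norm (adjoint (blinfun_apply (A x)) s)"
    using nondeg unfolding S_def Ax[symmetric]
    by (intro injective_imp_isometric closed_subspace subspace_direction_space
          linear_conv_bounded_linear[THEN iffD1] linear_adjoint_blinfun) (auto simp: mult.commute)
  then obtain c where c: "c > 0" "\<And>s. s \<in> S \<Longrightarrow> c * norm s \<le> norm (adjoint (blinfun_apply (A x)) s)"
    by blast
  have "(\<Phi> \<longlongrightarrow> \<Phi> x) (nhds x)" "(A \<longlongrightarrow> A x) (nhds x)"
    using has_derivative_continuous[OF A[OF U0(2)]] has_derivative_continuous[OF H[OF U0(2)]]
    by (simp_all add: continuous_within tendsto_at_iff_tendsto_nhds)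
  then have "\<forall>\<^sub>F y in nhds x. dist (\<Phi> y) (\<Phi> x) < \<epsilon> \<and> dist (A y) (A x) < c / 2"
    using \<epsilon> c(1) by (intro eventually_conj tendstoD) auto
  then obtain W where W: "open W" "x \<in> W" "\<And>y. y \<in> W \<Longrightarrow> norm (\<Phi> y - \<Phi> x) < \<epsilon> \<and> norm (A y - A x) < c / 2"
    unfolding eventually_nhds dist_norm by blast
  have "nondegenerate_composite \<phi> g \<Phi> A H (U0 \<inter> V \<inter> W) x l (c / 2)"
  proof
    show "c / 2 * norm s \<le> norm (adjoint (blinfun_apply (A y)) s)"
      if y: "y \<in> U0 \<inter> V \<inter> W" and s: "s \<in> direction_space (subdifferential g (\<Phi> x))" for y s
    proof -
      have "adjoint (blinfun_apply (A x)) s = adjoint (blinfun_apply (A y)) s - adjoint (blinfun_apply (A y - A x)) s"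
        by (rule vector_eq_rdot[THEN iffD1])
          (simp add: inner_diff_left adjoint_blinfun_inner blinfun.diff_left inner_diff_right)
      then have "c * norm s \<le> norm (adjoint (blinfun_apply (A y)) s) + norm (adjoint (blinfun_apply (A y - A x)) s)"
        using c(2)[of s] s norm_triangle_ineq4 unfolding S_def by (metis order_trans)
      also have "norm (adjoint (blinfun_apply (A y - A x)) s) \<le> norm (A y - A x) * norm s"
        by (rule norm_adjoint_blinfun)
      also have "\<dots> \<le> c / 2 * norm s"
        using W(3)[of y] y by (intro mult_right_mono) auto
      finally show ?thesis by simp
    qed
    show "subdifferential g (\<Phi> y) = {l \<in> subdifferential g (\<Phi> x).
        \<forall>m\<in>subdifferential g (\<Phi> x). m \<bullet> (\<Phi> y - \<Phi> x) \<le> l \<bullet> (\<Phi> y - \<Phi> x)}" if "y \<in> U0 \<inter> V \<inter> W" for y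
      using W(3)[of y] that by (intro near) auto
    show "continuous_on (U0 \<inter> V \<inter> W) H" by (rule continuous_on_subset[OF H_cont]) auto
  qed (use g U0 rep W A H l c(1) in auto)
  then show ?thesis using that Ax by blast
qed

lemma transpose_jacobian:
  fixes \<Phi> :: "real^'n \<Rightarrow> real^'m"
  assumes "\<Phi> differentiable (at x)"
  shows "transpose (jacobian \<Phi> (at x)) *v s = adjoint (frechet_derivative \<Phi> (at x)) s"
proof -
  have "linear (frechet_derivative \<Phi> (at x))" by (rule linear_frechet_derivative[OF assms])
  then have "(\<lambda>w. jacobian \<Phi> (at x) *v w) = frechet_derivative \<Phi> (at x)"
    unfolding jacobian_def by (simp add: matrix_works)
  then show ?thesis using adjoint_matrix[of "jacobian \<Phi> (at x)"] by metis
qed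

theorem theorem3p12:
  fixes \<phi> :: "real^'n \<Rightarrow> ereal"
    and g :: "real^'m \<Rightarrow> ereal"
    and \<Phi> :: "real^'n \<Rightarrow> real^'m"
    and x v :: "real^'n"
    and l :: "real^'m"
  assumes "\<bar>\<phi> x\<bar> \<noteq> \<infinity>"
    and "composite_representation \<phi> g \<Phi> x"
    and "v \<in> subdifferential \<phi> x"
    and "l \<in> multipliers g \<Phi> x v"
    and "SOQC g \<Phi> x l"
  shows "(v \<in> rel_interior (subdifferential \<phi> x) \<longleftrightarrow>
            regular_normal_cone (gph (subdifferential \<phi>)) (x, v)
              = limiting_normal_cone (gph (subdifferential \<phi>)) (x, v))
       \<and> (regular_normal_cone (gph (subdifferential \<phi>)) (x, v)
              = limiting_normal_cone (gph (subdifferential \<phi>)) (x, v) \<longleftrightarrow>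
            (\<forall>w. graphical_derivative (subdifferential \<phi>) x v w
                   = coderivative (subdifferential \<phi>) x v w))"
proof -
  have C2: "C2_around \<Phi> x" and g: "polyhedral_fun g"
    using assms(2) by (auto simp: composite_representation_def)
  obtain V where V: "open V" "x \<in> V" "\<And>y. y \<in> V \<Longrightarrow> \<phi> y = g (\<Phi> y)"
    using assms(2) unfolding composite_representation_def by blast
  have "\<Phi> differentiable (at x)"
    using C2 unfolding C2_around_def differentiable_def by blast
  note tr = transpose_jacobian[OF this]
  have l: "l \<in> subdifferential g (\<Phi> x)" and v: "v = adjoint (frechet_derivative \<Phi> (at x)) l"
    using assms(4) unfolding multipliers_def mem_Collect_eq tr by auto
  \<comment> \<open>A direction killed by the adjoint Jacobian lies in the intersection that SOQC
    declares trivial; this is where SOQC enters.\<close>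
  have "s = 0" if "s \<in> direction_space (subdifferential g (\<Phi> x))"
    "adjoint (frechet_derivative \<Phi> (at x)) s = 0" for s
    using direction_space_subset_coderivative[OF g l that(1)] that(2) assms(5)
    unfolding SOQC_def tr by blast
  then obtain A H U c where nc: "nondegenerate_composite \<phi> g \<Phi> A H U x l c"
    and Ax: "blinfun_apply (A x) = frechet_derivative \<Phi> (at x)"
    using nondegenerate_composite_exists[OF C2 g V l] by blast
  interpret nondegenerate_composite \<phi> g \<Phi> A H U x l c by (rule nc)
  have v: "v = adjoint (blinfun_apply (A x)) l" by (simp add: v Ax)
  show ?thesis
    unfolding v
    using ri_subdifferential_iff ri_imp_regular regular_imp_ri ri_imp_derivative_eq_coderivative
      derivative_eq_coderivative_imp_ri by blast
qed

end
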